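(* Let $\mathcal X$ be an exponentiable Lie-Bäcklund field in $J^\infty(\mathbb R^n,\mathbb R^m)$ and let $\Phi_t=(\Xi_{it},H^\alpha_{Lt})$ be its flow. Given a finite set $C$ of multipairs, there exists a real number $k_0$ (with $k_0\ge|B|$ and $k_0\ge|C|$) such that, for all integers $k\ge k_0$, the flow $\Phi^{(k)}_t=(\Phi^{(k)}_{it},\Phi^{(k)\alpha}_{Lt})$ of the vector field $\mathcal X^{(k)}$ in $J^k(\mathbb R^n,\mathbb R^m)$ satisfies $$\Phi^{(k)\alpha}_{Lt}=H^\alpha_{Lt}\quad\text{for all }(L,\alpha)\in C,\qquad \Phi^{(k)}_{it}=\Xi_{it}\quad\text{for } i=1,\dots,n.$$
   Context: Notation. A multiindex is $\alpha\in\mathbb Z_{\ge0}^n$, $|\alpha|=\sum_i\alpha_i$; letters $i,j,k\in\{1,\dots,n\}$ also denote unit multiindices. A multipair is $(L,\alpha)$ with $L\in\{1,\dots,m\}$ and $\alpha$ a multiindex. For a set $A$ of multipairs, $|A|=\sup\{|\alpha|:(L,\alpha)\in A\}$; every set of multipairs is assumed to contain $(L,0)$ for each $L$. $J^\infty(\mathbb R^n,\mathbb R^m)$ has coordinates $x_i$ and $y^\alpha_L$ for all multipairs; $J^k(\mathbb R^n,\mathbb R^m)$ has coordinates $x_i$ and $y^\alpha_L$ with $|\alpha|\le k$. Functions on (open parts of) $J^\infty$ are $C^\infty$ functions of finitely many coordinates; vector fields have such functions as coefficients and maps have such functions as components. $\mathbb D^i=\frac{\partial}{\partial x_i}+\sum_{(L,\alpha)}y_L^{\alpha+i}\frac{\partial}{\partial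 y_L^\alpha}$. A Lie-Bäcklund field in $J^\infty(\mathbb R^n,\mathbb R^m)$ is a vector field $\mathcal X=\sum_i\xi_i\frac{\partial}{\partial x_i}+\sum_{(L,\alpha)}\eta^\alpha_L\frac{\partial}{\partial y^\alpha_L}$ with $\eta^{\alpha+j}_L=\mathbb D^j\eta^\alpha_L-\sum_iy^{\alpha+i}_L\mathbb D^j\xi_i$ for all $(L,\alpha)$ and $j\in\{1,\dots,n\}$. It is exponentiable if it has a local flow $\Phi_t=(\Xi_{it},H^\alpha_{Lt})$: a local map in (point, $t$) whose components are smooth, each depending on a finite set of coordinates that can be chosen independent of $t$, with $\Phi_0=\mathrm{id}$, $\Phi_t\circ\Phi_s=\Phi_{t+s}$, $\frac{d}{dt}\Xi_{it}|_{t=0}=\xi_i$, $\frac{d}{dt}H^\alpha_{Lt}|_{t=0}=\eta^\alpha_L$. Flows are local, and identities between them are understood locally (for $t$ near $0$, where both sides are defined). The set $B$ (which is finite): $B=\{(M,\beta):\exists i,\ \partial\xi_i/\partial y^\beta_M\ne0\ \text{or}\ \exists L,\ \partial\eta^0_L/\partial y^\beta_M\neq0\}$ (together with all $(L,0)$). The field $\mathcal X^{(k)}$: for each integer $k\ge|B|$, each $\eta^\alpha_L$ is a polynomial in the variables $y^\gamma_M$ with $|\gamma|>k$, with coefficients that are functions only of $x$ and the $y^\gamma_M$ with $|\gamma|\le k$. Let $\eta^{k\alpha}_L$ be the homogeneous term of degree zero of this polynomial. Then $$\mathcal X^{(k)}=\sum_i\xi_i\frac{\partial}{\partial x_i}+\sum_L\eta^0_L\frac{\partial}{\partial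 y^0_L}+\sum_{(L,\alpha),\,0<|\alpha|\le k}\eta^{k\alpha}_L\frac{\partial}{\partial y^\alpha_L},$$ a vector field in $J^k(\mathbb R^n,\mathbb R^m)$; $\Phi^{(k)}_t$ denotes its ordinary (local) flow, with $x_i$-components $\Phi^{(k)}_{it}$ and $y^\alpha_L$-components $\Phi^{(k)\alpha}_{Lt}$. *)

theory Defs
  imports "HOL-Analysis.Analysis"
begin

type_synonym 'n multiindex = "'n \<Rightarrow> nat"
type_synonym ('n, 'm) multipair = "'m \<times> 'n multiindex"

definition msize :: "('n::finite) multiindex \<Rightarrow> nat" where
  "msize \<alpha> = (\<Sum>i\<in>UNIV. \<alpha> i)"

text \<open>\<open>inc \<alpha> j\<close> is \<open>\<alpha> + j\<close>, with \<open>j\<close> read as a unit multiindex.\<close>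

definition inc :: "'n multiindex \<Rightarrow> 'n \<Rightarrow> 'n multiindex" where
  "inc \<alpha> j = \<alpha>(j := Suc (\<alpha> j))"

definition mp_size :: "('n::finite, 'm) multipair set \<Rightarrow> ereal" where
  "mp_size A = (SUP (L, \<alpha>)\<in>A. ereal (real (msize \<alpha>)))"

text \<open>\<open>XC i\<close> is the coordinate \<open>x\<^sub>i\<close>, and \<open>YC L \<alpha>\<close> is the coordinate \<open>y\<close> with lower index \<open>L\<close>
  and upper index \<open>\<alpha>\<close>.\<close>

datatype ('n, 'm) coord = XC 'n | YC 'm "'n \<Rightarrow> nat"

type_synonym 'c point = "'c \<Rightarrow> real"

text \<open>The space with coordinate set \<open>A\<close> is \<open>PiE A (\<lambda>_. UNIV)\<close> with the product topology.
  The infinite jet space is the case \<open>A = UNIV\<close>, the \<open>k\<close>-jet space is \<open>A = jet_coords k\<close>,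
  and \<open>restrict p (jet_coords k)\<close> is the projection of \<open>p\<close> to the \<open>k\<close>-jet space.\<close>

abbreviation space_of :: "'c set \<Rightarrow> 'c point topology" where
  "space_of A \<equiv> product_topology (\<lambda>_. euclideanreal) A"

definition jet_coords :: "nat \<Rightarrow> ('n::finite, 'm) coord set" where
  "jet_coords k = range XC \<union> {YC L \<alpha> | L \<alpha>. msize \<alpha> \<le> k}"

definition partial :: "'c \<Rightarrow> ('c point \<Rightarrow> real) \<Rightarrow> 'c point \<Rightarrow> real" where
  "partial c f p = deriv (\<lambda>h. f (p(c := h))) (p c)"

definition depends_only_on :: "'c set \<Rightarrow> 'c point set \<Rightarrow> ('c point \<Rightarrow> real) \<Rightarrow> bool" where
  "depends_only_on F S f \<longleftrightarrow> (\<forall>p\<in>S. \<forall>q\<in>S. (\<forall>c\<in>F. p c = q c) \<longrightarrow> f p = f q)"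

text \<open>Here \<open>S\<close> is meant to be an open subset of \<open>space_of A\<close>; values of \<open>f\<close> outside \<open>S\<close> are
  irrelevant, since \<open>partial\<close> depends only on the germ of \<open>f\<close>.\<close>

definition smooth_on :: "'c set \<Rightarrow> 'c point set \<Rightarrow> ('c point \<Rightarrow> real) \<Rightarrow> bool" where
  "smooth_on A S f \<longleftrightarrow>
     (\<exists>F. finite F \<and> F \<subseteq> A \<and> depends_only_on F S f) \<and>
     (\<forall>cs\<in>lists A.
        continuous_map (subtopology (space_of A) S) euclideanreal (foldr partial cs f) \<and>
        (\<forall>c\<in>A. \<forall>p\<in>S. (\<lambda>h. foldr partial cs f (p(c := h))) differentiable at (p c)))"

text \<open>A vector field \<open>V\<close> assigns to each point \<open>p\<close> and coordinate \<open>c\<close> the coefficient \<open>V p c\<close> of the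
  partial derivative along \<open>c\<close>.\<close>

type_synonym 'c vfield = "'c point \<Rightarrow> 'c \<Rightarrow> real"

text \<open>The sum over all multipairs is restricted to its nonzero terms, finitely many when \<open>f\<close> is a
  function of finitely many coordinates.\<close>

definition total_deriv ::
  "'n \<Rightarrow> (('n, 'm) coord point \<Rightarrow> real) \<Rightarrow> ('n, 'm) coord point \<Rightarrow> real" where
  "total_deriv i f p =
     partial (XC i) f p +
     (\<Sum>(L, \<alpha>) | partial (YC L \<alpha>) f p \<noteq> 0. p (YC L (inc \<alpha> i)) * partial (YC L \<alpha>) f p)"

definition lie_backlund :: "('n::finite, 'm) coord vfield \<Rightarrow> bool" where
  "lie_backlund V \<longleftrightarrow>
     (\<forall>c. smooth_on UNIV UNIV (\<lambda>p. V p c)) \<and>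
     (\<forall>L \<alpha> j p.
        V p (YC L (inc \<alpha> j)) =
          total_deriv j (\<lambda>q. V q (YC L \<alpha>)) p -
          (\<Sum>i\<in>UNIV. p (YC L (inc \<alpha> i)) * total_deriv j (\<lambda>q. V q (XC i)) p))"

text \<open>By convention every set of multipairs contains all pairs \<open>(L, 0)\<close>, hence the last set.\<close>

definition base_set :: "('n, 'm) coord vfield \<Rightarrow> ('n, 'm) multipair set" where
  "base_set V =
     {(M, \<beta>). (\<exists>i. partial (YC M \<beta>) (\<lambda>p. V p (XC i)) \<noteq> (\<lambda>_. 0)) \<or>
              (\<exists>L. partial (YC M \<beta>) (\<lambda>p. V p (YC L (\<lambda>_. 0))) \<noteq> (\<lambda>_. 0))}
     \<union> {(L, \<lambda>_. 0) | L. True}"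

text \<open>\<open>local_flow A V U W \<Phi>\<close>: on the space with coordinate set \<open>A\<close>, the map \<open>(p, t) \<mapsto> \<Phi> t p\<close>, with
  open domain \<open>W\<close>, is a local flow of \<open>V\<close> over the open set \<open>U\<close> of initial points. Smoothness
  is joint in the point and the time: in the coordinate set \<open>insert None (Some ` A)\<close> the
  coordinate \<open>None\<close> is the time. So the finite set of coordinates of the point on which a component
  depends is the same for all times. The group law is imposed locally, near \<open>(p, 0, 0)\<close>, where
  both sides are defined because \<open>W\<close> is open and \<open>\<Phi>\<close> is continuous.\<close>

definition local_flow ::
  "'c set \<Rightarrow> 'c vfield \<Rightarrow> 'c point set \<Rightarrow> ('c point \<times> real) set \<Rightarrow>
   (real \<Rightarrow> 'c point \<Rightarrow> 'c point) \<Rightarrow> bool" where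
  "local_flow A V U W \<Phi> \<longleftrightarrow>
     openin (space_of A) U \<and>
     openin (prod_topology (space_of A) euclideanreal) W \<and>
     U \<times> {0} \<subseteq> W \<and>
     (\<forall>(p, t)\<in>W. \<Phi> t p \<in> topspace (space_of A)) \<and>
     (\<forall>c\<in>A. smooth_on (insert None (Some ` A))
               {z \<in> topspace (space_of (insert None (Some ` A))). (z \<circ> Some, z None) \<in> W}
               (\<lambda>z. \<Phi> (z None) (z \<circ> Some) c)) \<and>
     (\<forall>p\<in>U. \<Phi> 0 p = p) \<and>
     (\<forall>p\<in>U. \<forall>\<^sub>F (q, s, t) in
        nhdsin (prod_topology (space_of A) (prod_topology euclideanreal euclideanreal)) (p, 0, 0).
        \<Phi> t (\<Phi> s q) = \<Phi> (t + s) q) \<and>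
     (\<forall>p\<in>U. \<forall>c\<in>A. ((\<lambda>t. \<Phi> t p c) has_real_derivative V p c) (at 0))"

definition exponentiable_on :: "('n, 'm) coord point set \<Rightarrow> ('n, 'm) coord vfield \<Rightarrow> bool" where
  "exponentiable_on U V \<longleftrightarrow> (\<exists>W \<Phi>. local_flow UNIV V U W \<Phi>)"

text \<open>\<open>poly_above k S a f\<close>: \<open>f\<close> is the polynomial in the coordinates outside \<open>jet_coords k\<close> with
  monomials \<open>\<mu> \<in> S\<close> (exponent functions of finite support) and coefficients \<open>a \<mu>\<close>.\<close>

definition poly_above ::
  "nat \<Rightarrow> (('n::finite, 'm) coord \<Rightarrow> nat) set \<Rightarrow>
   ((('n, 'm) coord \<Rightarrow> nat) \<Rightarrow> ('n, 'm) coord point \<Rightarrow> real) \<Rightarrow>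
   (('n, 'm) coord point \<Rightarrow> real) \<Rightarrow> bool" where
  "poly_above k S a f \<longleftrightarrow>
     finite S \<and>
     (\<forall>\<mu>\<in>S. finite {c. \<mu> c \<noteq> 0} \<and> {c. \<mu> c \<noteq> 0} \<inter> jet_coords k = {}) \<and>
     (\<forall>\<mu>\<in>S. smooth_on UNIV UNIV (a \<mu>) \<and> depends_only_on (jet_coords k) UNIV (a \<mu>)) \<and>
     (\<forall>p. f p = (\<Sum>\<mu>\<in>S. a \<mu> p * (\<Prod>c | \<mu> c \<noteq> 0. p c ^ \<mu> c)))"

definition degree_zero_term ::
  "nat \<Rightarrow> (('n::finite, 'm) coord point \<Rightarrow> real) \<Rightarrow> ('n, 'm) coord point \<Rightarrow> real" where
  "degree_zero_term k f =
     (THE g. \<exists>S a. poly_above k S a f \<and>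
        g = (\<lambda>p. \<Sum>\<mu> | \<mu> \<in> S \<and> (\<Sum>c | \<mu> c \<noteq> 0. \<mu> c) = 0. a \<mu> p))"

text \<open>A field on the \<open>k\<close>-jet space for \<open>k\<close> at least the size of \<open>base_set V\<close>: its coefficients along
  \<open>jet_coords k\<close> then do not depend on coordinates outside \<open>jet_coords k\<close>, so they may be evaluated
  at elements of \<open>PiE (jet_coords k) (\<lambda>_. UNIV)\<close>. Its values along the other coordinates are irrelevant.\<close>

definition truncated_field ::
  "nat \<Rightarrow> ('n::finite, 'm) coord vfield \<Rightarrow> ('n, 'm) coord vfield" where
  "truncated_field k V q c =
     (case c of
        XC i \<Rightarrow> V q (XC i)
      | YC L \<alpha> \<Rightarrow> if msize \<alpha> = 0 then V q (YC L \<alpha>)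
                  else degree_zero_term k (\<lambda>p. V p (YC L \<alpha>)) q)"

end

theory Submission
  imports Defs "HOL-Computational_Algebra.Polynomial"
begin

text \<open>Each component \<open>\<Phi>\<^sub>t(c)\<close> depends on finitely many coordinates and satisfies the transport
  equation \<open>\<partial>\<^sub>t \<Phi>\<^sub>t(c) = \<Sum> V\<^sub>d \<partial>\<^sub>d \<Phi>\<^sub>t(c)\<close>, the sum running over those coordinates. If \<open>k\<close> is so large
  that all of them lie in the \<open>k\<close>-jet space, the only dependence on higher coordinates is the
  polynomial one through the \<open>V\<^sub>d\<close>, so the equation persists when every \<open>V\<^sub>d\<close> is replaced by its
  term of degree zero, that is, when \<open>V\<close> is replaced by the truncated field. Hence
  \<open>\<Phi>\<close> at time \<open>t - s\<close>, evaluated along the flow line \<open>\<Psi>\<^sub>s\<close> of the truncated field, has a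
  component \<open>c\<close> independent of \<open>s\<close>; comparing \<open>s = 0\<close> with \<open>s = t\<close> gives the theorem.\<close>

subsection \<open>Smooth functions on the whole space\<close>

text \<open>The infinite jet space offers no uniqueness theorem for integral curves, so the two
  flows are not compared as solutions of one equation. A chain rule replaces uniqueness, and it is
  available because each component of \<Phi> sees only finitely many coordinates. Every coefficient
  of V is polynomial in the high coordinates because the recursion for V uses total derivatives, and
  these introduce new coordinates only as linear factors. The term of degree zero is the value at
  the point whose high coordinates are set to 0, so truncating V means evaluating it at scaling
  factor 0 in the high coordinates. The obstacle is that this point may lie outside the domain of
  \<Phi>, where the transport equation says nothing. The equation is therefore used for scaling
  factors near 1, where the partials of \<Phi> do not change, and carried to 0 as a polynomial
  identity. The bound on k precedes the choice of p, t and \<Psi>: smoothness is joint in point and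
  time, so one finite set of coordinates per component serves the whole domain W.\<close>

lemma smooth_on_UNIV_coinduct:
  assumes "f \<in> K"
    and "\<And>f. f \<in> K \<Longrightarrow> \<exists>F. finite F \<and> depends_only_on F UNIV f"
    and "\<And>f. f \<in> K \<Longrightarrow> continuous_on UNIV f"
    and "\<And>f c. f \<in> K \<Longrightarrow> \<exists>f'\<in>K. \<forall>p. ((\<lambda>h. f (p(c := h))) has_real_derivative f' p) (at (p c))"
  shows "smooth_on UNIV UNIV f"
proof -
  \<comment> \<open>Closure of K under one derivative puts every iterated partial in K; this is why
    continuity and differentiability are required of all members of K.\<close>
  have partial_mem: "partial c g \<in> K" if g: "g \<in> K" for c g
  proof -
    obtain g' where g': "g' \<in> K" "\<And>p. ((\<lambda>h. g (p(c := h))) has_real_derivative g' p) (at (p c))"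
      using assms(4)[OF g] by blast
    have "partial c g = g'"
      unfolding partial_def by (rule ext) (rule DERIV_imp_deriv[OF g'(2)])
    with g' show ?thesis by simp
  qed
  have foldr_mem: "foldr partial cs f \<in> K" for cs
    by (induction cs) (auto simp: assms(1) partial_mem)
  have "(\<lambda>h. g (p(c := h))) differentiable at (p c)" if "g \<in> K" for g c p
    using assms(4)[OF that, of c] by (metis real_differentiable_def)
  then show ?thesis
    using assms(2)[OF assms(1)] assms(3) foldr_mem
    by (auto simp: smooth_on_def euclidean_product_topology)
qed

lemma smooth_on_has_partial:
  assumes "smooth_on UNIV S f" "p \<in> S"
  shows "((\<lambda>h. f (p(c := h))) has_real_derivative partial c f p) (at (p c))"
proof -
  have "(\<lambda>h. foldr partial [] f (p(c := h))) differentiable at (p c)"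
    using assms unfolding smooth_on_def by (metis UNIV_I lists_UNIV)
  then show ?thesis
    by (simp add: partial_def DERIV_deriv_iff_real_differentiable)
qed

lemmas has_partial = smooth_on_has_partial[OF _ UNIV_I]

lemma smooth_on_continuous_foldr_partial:
  assumes "smooth_on UNIV S f"
  shows "continuous_on S (foldr partial cs f)"
proof -
  have "continuous_map (subtopology (space_of UNIV) S) euclideanreal (foldr partial cs f)"
    using assms unfolding smooth_on_def by (metis UNIV_I lists_UNIV)
  then show ?thesis by (simp add: euclidean_product_topology)
qed

lemma smooth_on_continuous: "smooth_on UNIV S f \<Longrightarrow> continuous_on S f"
  using smooth_on_continuous_foldr_partial[of S f "[]"] by simp

lemma smooth_on_continuous_partial: "smooth_on UNIV S f \<Longrightarrow> continuous_on S (partial c f)"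
  using smooth_on_continuous_foldr_partial[of S f "[c]"] by simp

lemma depends_only_on_partial_UNIV:
  assumes "depends_only_on F UNIV f"
  shows "depends_only_on F UNIV (partial c f)"
  unfolding depends_only_on_def
proof clarify
  fix p q :: "'a point" assume eq: "\<forall>c\<in>F. p c = q c"
  show "partial c f p = partial c f q"
  proof (cases "c \<in> F")
    case True
    then have "(\<lambda>h. f (p(c := h))) = (\<lambda>h. f (q(c := h)))" "p c = q c"
      using assms eq by (auto simp: depends_only_on_def intro!: ext)
    then show ?thesis by (simp add: partial_def)
  next
    case False
    have "(\<lambda>h. f (r(c := h))) = (\<lambda>_. f r)" for r
      using assms False by (auto simp: depends_only_on_def intro!: ext)
    then show ?thesis by (simp add: partial_def)
  qed
qed

lemma partial_eq_0:
  assumes "depends_only_on F UNIV f" "c \<notin> F"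
  shows "partial c f p = 0"
proof -
  have "(\<lambda>h. f (p(c := h))) = (\<lambda>_. f p)"
    using assms by (auto simp: depends_only_on_def intro!: ext)
  then show ?thesis by (simp add: partial_def)
qed

lemma smooth_on_partial:
  assumes "smooth_on UNIV UNIV f"
  shows "smooth_on UNIV UNIV (partial c f)"
proof -
  obtain F where "finite F" "depends_only_on F UNIV f"
    using assms by (auto simp: smooth_on_def)
  then have "\<exists>F. finite F \<and> F \<subseteq> UNIV \<and> depends_only_on F UNIV (partial c f)"
    using depends_only_on_partial_UNIV by (intro exI[of _ F]) simp
  moreover have "continuous_map (subtopology (space_of UNIV) UNIV) euclideanreal
          (foldr partial cs (partial c f))"
    "(\<lambda>h. foldr partial cs (partial c f) (p(d := h))) differentiable at (p d)" for cs d p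
    using assms[unfolded smooth_on_def, THEN conjunct2, rule_format, of "cs @ [c]"] by auto
  ultimately show ?thesis
    by (simp add: smooth_on_def)
qed

text \<open>The partials of a product are sums of products, so products of smooth functions alone do
  not visibly form a class closed under differentiation. The generated algebra does, and
  \<open>smooth_alg_smooth\<close> shows that it contains only smooth functions.\<close>

inductive_set smooth_alg :: "('c point \<Rightarrow> real) set" where
  base: "smooth_on UNIV UNIV f \<Longrightarrow> f \<in> smooth_alg"
| const: "(\<lambda>_. r) \<in> smooth_alg"
| coord: "(\<lambda>p. p c) \<in> smooth_alg"
| add: "f \<in> smooth_alg \<Longrightarrow> g \<in> smooth_alg \<Longrightarrow> (\<lambda>p. f p + g p) \<in> smooth_alg"
| mult: "f \<in> smooth_alg \<Longrightarrow> g \<in> smooth_alg \<Longrightarrow> (\<lambda>p. f p * g p) \<in> smooth_alg"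

lemma depends_only_onD:
  assumes "depends_only_on F S f" "p \<in> S" "q \<in> S" "\<And>c. c \<in> F \<Longrightarrow> p c = q c"
  shows "f p = f q"
  using assms(1)[unfolded depends_only_on_def, THEN bspec, OF assms(2), THEN bspec, OF assms(3)]
    assms(4) by (elim mp) blast

lemma depends_only_on_mono:
  "depends_only_on F S f \<Longrightarrow> F \<subseteq> G \<Longrightarrow> depends_only_on G S f"
  unfolding depends_only_on_def by (meson subsetD)

lemma depends_only_on_binop:
  assumes "depends_only_on F S f" "depends_only_on F S g"
  shows "depends_only_on F S (\<lambda>p. b (f p) (g p))"
  unfolding depends_only_on_def
proof (intro ballI impI)
  fix p q assume "p \<in> S" "q \<in> S" "\<forall>c\<in>F. p c = q c"
  then show "b (f p) (g p) = b (f q) (g q)"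
    by (intro arg_cong2[where f = b] depends_only_onD[OF assms(1)] depends_only_onD[OF assms(2)])
       simp_all
qed

lemma smooth_alg_finite_dependence:
  "f \<in> smooth_alg \<Longrightarrow> \<exists>F. finite F \<and> depends_only_on F UNIV f"
proof (induction rule: smooth_alg.induct)
  case (base f)
  then show ?case by (auto simp: smooth_on_def)
next
  case (const r)
  then show ?case by (auto simp: depends_only_on_def)
next
  case (coord c)
  show ?case by (rule exI[of _ "{c}"]) (auto simp: depends_only_on_def)
next
  case (add f g)
  then obtain F G where "finite F" "finite G" "depends_only_on F UNIV f" "depends_only_on G UNIV g"
    by blast
  then have "depends_only_on (F \<union> G) UNIV f" "depends_only_on (F \<union> G) UNIV g" "finite (F \<union> G)"
    by (auto elim!: depends_only_on_mono)
  then show ?case by (blast intro: depends_only_on_binop[where b = "(+)"])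
next
  case (mult f g)
  then obtain F G where "finite F" "finite G" "depends_only_on F UNIV f" "depends_only_on G UNIV g"
    by blast
  then have "depends_only_on (F \<union> G) UNIV f" "depends_only_on (F \<union> G) UNIV g" "finite (F \<union> G)"
    by (auto elim!: depends_only_on_mono)
  then show ?case by (blast intro: depends_only_on_binop[where b = "(*)"])
qed

lemma smooth_alg_smooth: "f \<in> smooth_alg \<Longrightarrow> smooth_on UNIV UNIV f"
proof (erule smooth_on_UNIV_coinduct)
  show "continuous_on UNIV f" if "f \<in> smooth_alg" for f :: "'c point \<Rightarrow> real"
    using that by induction (auto intro: smooth_on_continuous continuous_on_add continuous_on_mult)
  show "\<exists>f'\<in>smooth_alg. \<forall>p. ((\<lambda>h. f (p(c := h))) has_real_derivative f' p) (at (p c))"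
    if "f \<in> smooth_alg" for f :: "'c point \<Rightarrow> real" and c
    using that
  proof induction
    case (base f)
    then show ?case
      by (intro bexI[of _ "partial c f"] smooth_alg.base smooth_on_partial allI has_partial)
  next
    case (const r)
    show ?case by (intro bexI[of _ "\<lambda>_. 0"] smooth_alg.const) auto
  next
    case (coord d)
    show ?case
      by (intro bexI[of _ "\<lambda>_. if c = d then 1 else 0"] smooth_alg.const) auto
  next
    case (add f g)
    then obtain f' g' where "f' \<in> smooth_alg" "g' \<in> smooth_alg"
      "\<And>p. ((\<lambda>h. f (p(c := h))) has_real_derivative f' p) (at (p c))"
      "\<And>p. ((\<lambda>h. g (p(c := h))) has_real_derivative g' p) (at (p c))" by blast
    then show ?case
      by (intro bexI[of _ "\<lambda>p. f' p + g' p"] smooth_alg.add allI DERIV_add)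
  next
    case (mult f g)
    then obtain f' g' where d: "f' \<in> smooth_alg" "g' \<in> smooth_alg"
      "\<And>p. ((\<lambda>h. f (p(c := h))) has_real_derivative f' p) (at (p c))"
      "\<And>p. ((\<lambda>h. g (p(c := h))) has_real_derivative g' p) (at (p c))" by blast
    have "((\<lambda>h. f (p(c := h)) * g (p(c := h))) has_real_derivative f' p * g p + g' p * f p) (at (p c))"
      for p
      using DERIV_mult[OF d(3)[of p] d(4)[of p]] by simp
    then show ?case
      by (intro bexI[of _ "\<lambda>p. f' p * g p + g' p * f p"] smooth_alg.add smooth_alg.mult
          allI d(1,2) mult.hyps)
  qed
qed (rule smooth_alg_finite_dependence)

lemma smooth_on_const [simp]: "smooth_on UNIV UNIV (\<lambda>_. r)"
  by (intro smooth_alg_smooth smooth_alg.const)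

lemma smooth_on_coord [simp]: "smooth_on UNIV UNIV (\<lambda>p. p c)"
  by (intro smooth_alg_smooth smooth_alg.coord)

lemma smooth_on_add:
  "smooth_on UNIV UNIV f \<Longrightarrow> smooth_on UNIV UNIV g \<Longrightarrow> smooth_on UNIV UNIV (\<lambda>p. f p + g p)"
  by (rule smooth_alg_smooth) (intro smooth_alg.add smooth_alg.base)

lemma smooth_on_mult:
  "smooth_on UNIV UNIV f \<Longrightarrow> smooth_on UNIV UNIV g \<Longrightarrow> smooth_on UNIV UNIV (\<lambda>p. f p * g p)"
  by (rule smooth_alg_smooth) (intro smooth_alg.mult smooth_alg.base)

lemma partial_add:
  assumes "smooth_on UNIV UNIV f" "smooth_on UNIV UNIV g"
  shows "partial c (\<lambda>p. f p + g p) p = partial c f p + partial c g p"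
  unfolding partial_def[of c "\<lambda>p. f p + g p"]
  by (intro DERIV_imp_deriv DERIV_add has_partial assms)

lemma partial_mult:
  assumes "smooth_on UNIV UNIV f" "smooth_on UNIV UNIV g"
  shows "partial c (\<lambda>p. f p * g p) p = partial c f p * g p + partial c g p * f p"
  unfolding partial_def[of c "\<lambda>p. f p * g p"]
  using DERIV_mult[OF has_partial[OF assms(1), of p c] has_partial[OF assms(2), of p c]]
  by (intro DERIV_imp_deriv) simp

lemma partial_coord: "partial c (\<lambda>p. p d) p = (if c = d then 1 else 0)"
  unfolding partial_def by (auto intro!: DERIV_imp_deriv)

subsection \<open>The total derivative\<close>

text \<open>The index set in \<open>total_deriv\<close> varies with the function and the point. A
  fixed finite one makes the total derivatives of two functions and of their sum or product
  comparable term by term.\<close>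

lemma total_deriv_eq_sum:
  assumes "depends_only_on F UNIV f" "finite T" "\<And>L \<alpha>. YC L \<alpha> \<in> F \<Longrightarrow> (L, \<alpha>) \<in> T"
  shows "total_deriv i f p =
    partial (XC i) f p + (\<Sum>(L, \<alpha>)\<in>T. p (YC L (inc \<alpha> i)) * partial (YC L \<alpha>) f p)"
proof -
  have "(L, \<alpha>) \<in> T" if "partial (YC L \<alpha>) f p \<noteq> 0" for L \<alpha>
    using that partial_eq_0[OF assms(1)] assms(3) by metis
  then have "(\<Sum>(L, \<alpha>) | partial (YC L \<alpha>) f p \<noteq> 0. p (YC L (inc \<alpha> i)) * partial (YC L \<alpha>) f p)
      = (\<Sum>(L, \<alpha>)\<in>T. p (YC L (inc \<alpha> i)) * partial (YC L \<alpha>) f p)"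
    using assms(2) by (intro sum.mono_neutral_left) auto
  then show ?thesis by (simp add: total_deriv_def)
qed

lemma common_finite_dependence:
  assumes "smooth_on UNIV UNIV f" "smooth_on UNIV UNIV g"
  obtains F where "finite F" "depends_only_on F UNIV f" "depends_only_on F UNIV g"
proof -
  obtain F G where "finite F" "depends_only_on F UNIV f" "finite G" "depends_only_on G UNIV g"
    using assms unfolding smooth_on_def by blast
  then show thesis
    by (intro that[of "F \<union> G"]) (auto elim!: depends_only_on_mono)
qed

lemma finite_multipairs: "finite F \<Longrightarrow> finite {(L, \<alpha>). YC L \<alpha> \<in> F}"
proof -
  assume "finite F"
  then have "finite ((\<lambda>(L, \<alpha>). YC L \<alpha>) -` F)"
    by (rule finite_vimageI) (auto intro!: injI)
  then show ?thesis by (simp add: vimage_def case_prod_unfold)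
qed

lemma total_deriv_add:
  assumes f: "smooth_on UNIV UNIV f" and g: "smooth_on UNIV UNIV g"
  shows "total_deriv i (\<lambda>p. f p + g p) p = total_deriv i f p + total_deriv i g p"
proof -
  obtain F where F: "finite F" "depends_only_on F UNIV f" "depends_only_on F UNIV g"
    using common_finite_dependence[OF f g] .
  have fg: "depends_only_on F UNIV (\<lambda>p. f p + g p)"
    by (rule depends_only_on_binop[OF F(2,3)])
  define T where "T = {(L, \<alpha>). YC L \<alpha> \<in> F}"
  have eq: "total_deriv i h p =
      partial (XC i) h p + (\<Sum>(L, \<alpha>)\<in>T. p (YC L (inc \<alpha> i)) * partial (YC L \<alpha>) h p)"
    if "depends_only_on F UNIV h" for h
    using that finite_multipairs[OF F(1)] by (intro total_deriv_eq_sum) (auto simp: T_def)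
  show ?thesis
    unfolding eq[OF fg] eq[OF F(2)] eq[OF F(3)]
    by (simp add: sum.distrib partial_add[OF f g] case_prod_unfold algebra_simps)
qed

lemma total_deriv_mult:
  assumes f: "smooth_on UNIV UNIV f" and g: "smooth_on UNIV UNIV g"
  shows "total_deriv i (\<lambda>p. f p * g p) p = total_deriv i f p * g p + total_deriv i g p * f p"
proof -
  obtain F where F: "finite F" "depends_only_on F UNIV f" "depends_only_on F UNIV g"
    using common_finite_dependence[OF f g] .
  have fg: "depends_only_on F UNIV (\<lambda>p. f p * g p)"
    by (rule depends_only_on_binop[OF F(2,3)])
  define T where "T = {(L, \<alpha>). YC L \<alpha> \<in> F}"
  have eq: "total_deriv i h p =
      partial (XC i) h p + (\<Sum>(L, \<alpha>)\<in>T. p (YC L (inc \<alpha> i)) * partial (YC L \<alpha>) h p)"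
    if "depends_only_on F UNIV h" for h
    using that finite_multipairs[OF F(1)] by (intro total_deriv_eq_sum) (auto simp: T_def)
  show ?thesis
    unfolding eq[OF fg] eq[OF F(2)] eq[OF F(3)]
    by (simp add: sum.distrib partial_mult[OF f g] sum_distrib_left sum_distrib_right case_prod_unfold algebra_simps)
qed

lemma total_deriv_XC: "total_deriv i (\<lambda>p. p (XC j)) p = (if i = j then 1 else 0)"
  by (subst total_deriv_eq_sum[of "{XC j}" _ "{}"]) (simp_all add: depends_only_on_def partial_coord)

lemma total_deriv_YC: "total_deriv i (\<lambda>p. p (YC L \<alpha>)) p = p (YC L (inc \<alpha> i))"
  by (subst total_deriv_eq_sum[of "{YC L \<alpha>}" _ "{(L, \<alpha>)}"])
     (simp_all add: depends_only_on_def partial_coord)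

subsection \<open>Polynomials in the high jet coordinates\<close>

text \<open>Polynomials in the high coordinates over smooth functions of the low ones, given by
  generators: closure under \<open>total_deriv\<close> becomes an induction with the Leibniz rule,
  and no monomial expansion has to be differentiated.\<close>

inductive_set jet_poly :: "nat \<Rightarrow> (('n::finite, 'm) coord point \<Rightarrow> real) set" for k where
  base: "smooth_on UNIV UNIV f \<Longrightarrow> depends_only_on (jet_coords k) UNIV f \<Longrightarrow> f \<in> jet_poly k"
| coord: "(\<lambda>p. p c) \<in> jet_poly k"
| add: "f \<in> jet_poly k \<Longrightarrow> g \<in> jet_poly k \<Longrightarrow> (\<lambda>p. f p + g p) \<in> jet_poly k"
| mult: "f \<in> jet_poly k \<Longrightarrow> g \<in> jet_poly k \<Longrightarrow> (\<lambda>p. f p * g p) \<in> jet_poly k"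

lemma jet_poly_const: "(\<lambda>_. r) \<in> jet_poly k"
  by (rule jet_poly.base) (simp_all add: depends_only_on_def)

lemma jet_poly_sum:
  assumes "\<And>i. i \<in> I \<Longrightarrow> f i \<in> jet_poly k"
  shows "(\<lambda>p. \<Sum>i\<in>I. f i p) \<in> jet_poly k"
  using assms
  by (induction I rule: infinite_finite_induct) (simp_all add: jet_poly_const jet_poly.add)

lemma jet_poly_diff:
  assumes "f \<in> jet_poly k" "g \<in> jet_poly k"
  shows "(\<lambda>p. f p - g p) \<in> jet_poly k"
  using jet_poly.add[OF assms(1) jet_poly.mult[OF jet_poly_const[of "-1"] assms(2)]] by simp

lemma jet_poly_smooth: "f \<in> jet_poly k \<Longrightarrow> smooth_on UNIV UNIV f"
  by (induction rule: jet_poly.induct) (simp_all add: smooth_on_add smooth_on_mult)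

lemma jet_poly_total_deriv: "f \<in> jet_poly k \<Longrightarrow> total_deriv i f \<in> jet_poly k"
proof (induction rule: jet_poly.induct)
  case (base f)
  \<comment> \<open>The finite set G only indexes the sum. That the partials stay free of high
    coordinates comes from the dependence of f on \<open>jet_coords k\<close>; high coordinates
    enter only through the factors \<open>p (YC L (inc \<alpha> i))\<close>.\<close>
  obtain G where G: "finite G" "depends_only_on G UNIV f"
    using base(1) by (auto simp: smooth_on_def)
  define T where "T = {(L, \<alpha>). YC L \<alpha> \<in> G}"
  have "total_deriv i f = (\<lambda>p. partial (XC i) f p +
      (\<Sum>x\<in>T. p (YC (fst x) (inc (snd x) i)) * partial (YC (fst x) (snd x)) f p))"
    using total_deriv_eq_sum[OF G(2), of T] finite_multipairs[OF G(1)]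
    by (intro ext) (simp add: T_def case_prod_unfold)
  moreover have "partial c f \<in> jet_poly k" for c
    by (intro jet_poly.base smooth_on_partial depends_only_on_partial_UNIV base.hyps)
  ultimately show ?case
    by (simp only:) (intro jet_poly.add jet_poly_sum jet_poly.mult jet_poly.coord)
next
  case (coord c)
  show ?case
  proof (cases c)
    case (XC j)
    then have "total_deriv i (\<lambda>p. p c) = (\<lambda>_. if i = j then 1 else 0)"
      by (auto simp: total_deriv_XC)
    then show ?thesis by (simp only: jet_poly_const)
  next
    case (YC L \<alpha>)
    then have "total_deriv i (\<lambda>p. p c) = (\<lambda>p. p (YC L (inc \<alpha> i)))"
      by (auto simp: total_deriv_YC)
    then show ?thesis by (simp only: jet_poly.coord)
  qed
next
  case (add f g)
  have "total_deriv i (\<lambda>p. f p + g p) = (\<lambda>p. total_deriv i f p + total_deriv i g p)"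
    using add.hyps by (intro ext total_deriv_add jet_poly_smooth)
  with add.IH show ?case by (simp only: jet_poly.add)
next
  case (mult f g)
  have "total_deriv i (\<lambda>p. f p * g p) = (\<lambda>p. total_deriv i f p * g p + total_deriv i g p * f p)"
    using mult.hyps by (intro ext total_deriv_mult jet_poly_smooth)
  with mult show ?case by (simp only: jet_poly.add jet_poly.mult)
qed

lemma multiindex_inc_cases:
  fixes \<alpha> :: "'n::finite multiindex"
  obtains "\<alpha> = (\<lambda>_. 0)" | \<beta> j where "\<alpha> = inc \<beta> j" "msize \<beta> < msize \<alpha>"
proof (cases "\<alpha> = (\<lambda>_. 0)")
  case False
  then obtain j where j: "\<alpha> j \<noteq> 0" by auto
  define \<beta> where "\<beta> = \<alpha>(j := \<alpha> j - 1)"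
  have "\<alpha> = inc \<beta> j" using j by (auto simp: \<beta>_def inc_def)
  moreover have "msize \<beta> < msize \<alpha>"
    unfolding msize_def \<beta>_def using j by (intro sum_strict_mono_ex1) auto
  ultimately show thesis using that(2) by blast
qed (use that(1) in blast)

text \<open>The recursion builds each coefficient from those along \<open>XC i\<close> and
  \<open>YC L (\<lambda>_. 0)\<close> by total derivatives, products, sums and differences, all of
  which preserve \<open>jet_poly k\<close>.\<close>

lemma lie_backlund_jet_poly:
  assumes "lie_backlund V"
    and XC: "\<And>i. depends_only_on (jet_coords k) UNIV (\<lambda>p. V p (XC i))"
    and YC: "\<And>L. depends_only_on (jet_coords k) UNIV (\<lambda>p. V p (YC L (\<lambda>_. 0)))"
  shows "(\<lambda>p. V p c) \<in> jet_poly k"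
proof -
  have smooth: "smooth_on UNIV UNIV (\<lambda>p. V p c)" for c
    using assms(1) unfolding lie_backlund_def by blast
  have X: "(\<lambda>p. V p (XC i)) \<in> jet_poly k" for i
    by (rule jet_poly.base[OF smooth XC])
  have Y: "(\<lambda>p. V p (YC L \<alpha>)) \<in> jet_poly k" for L \<alpha>
  proof (induction \<alpha> rule: measure_induct_rule[where f = msize])
    case (less \<alpha>)
    show ?case
    proof (cases \<alpha> rule: multiindex_inc_cases)
      case 1
      then show ?thesis using jet_poly.base[OF smooth YC] by simp
    next
      case (2 \<beta> j)
      have "(\<lambda>p. V p (YC L \<alpha>)) = (\<lambda>p. total_deriv j (\<lambda>q. V q (YC L \<beta>)) p -
          (\<Sum>i\<in>UNIV. p (YC L (inc \<beta> i)) * total_deriv j (\<lambda>q. V q (XC i)) p))"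
        using assms(1) unfolding lie_backlund_def 2(1) by blast
      then show ?thesis
        by (simp only:) (intro jet_poly_diff jet_poly_sum jet_poly.mult jet_poly.coord
            jet_poly_total_deriv X less 2)
    qed
  qed
  show ?thesis using X Y by (cases c) auto
qed

text \<open>When the high coordinates are multiplied by s, functions of the low ones stay constant
  and each high coordinate is linear in s. An identity in many variables thus becomes one about a
  polynomial in one variable.\<close>

lemma jet_poly_scaling:
  assumes "f \<in> jet_poly k"
  shows "\<exists>P. \<forall>s. f (\<lambda>c. if c \<in> jet_coords k then p c else s * p c) = poly P s"
  using assms
proof (induction rule: jet_poly.induct)
  case (base f)
  have "f (\<lambda>c. if c \<in> jet_coords k then p c else s * p c) = poly [:f p:] s" for s
    using base(2) by (auto simp: depends_only_on_def)
  then show ?case by blast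
next
  case (coord c)
  show ?case
    by (rule exI[of _ "if c \<in> jet_coords k then [:p c:] else [:0, p c:]"]) simp
next
  case (add f g)
  then show ?case by (metis poly_add)
next
  case (mult f g)
  then show ?case by (metis poly_mult)
qed

section \<open>Monomial expansions and the term of degree zero\<close>

definition monomial_at :: "('c \<Rightarrow> nat) \<Rightarrow> 'c point \<Rightarrow> real" where
  "monomial_at \<mu> p = (\<Prod>c | \<mu> c \<noteq> 0. p c ^ \<mu> c)"

lemma monomial_at_add:
  assumes "finite {c. \<mu> c \<noteq> 0}" "finite {c. \<nu> c \<noteq> 0}"
  shows "monomial_at (\<lambda>c. \<mu> c + \<nu> c) p = monomial_at \<mu> p * monomial_at \<nu> p"
proof -
  \<comment> \<open>Factors outside a support are \<open>p c ^ 0 = 1\<close>, so all three products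
    may be taken over the union of the supports.\<close>
  let ?A = "{c. \<mu> c \<noteq> 0} \<union> {c. \<nu> c \<noteq> 0}"
  have *: "monomial_at \<kappa> p = (\<Prod>c\<in>?A. p c ^ \<kappa> c)" if "{c. \<kappa> c \<noteq> 0} \<subseteq> ?A" for \<kappa>
    unfolding monomial_at_def using assms that by (intro prod.mono_neutral_left) auto
  show ?thesis
    by (subst (1 2 3) *) (auto simp: power_add prod.distrib)
qed

lemma poly_above_term:
  assumes "smooth_on UNIV UNIV a" "depends_only_on (jet_coords k) UNIV a"
    and "finite {c. \<mu> c \<noteq> 0}" "{c. \<mu> c \<noteq> 0} \<inter> jet_coords k = {}"
  shows "poly_above k {\<mu>} (\<lambda>_. a) (\<lambda>p. a p * monomial_at \<mu> p)"
  using assms by (simp add: poly_above_def monomial_at_def)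

text \<open>Outside S the coefficients \<open>a\<close> are unconstrained, so they are cut off to 0
  before both expansions are put on a common index set; likewise \<open>b\<close> outside T.\<close>

lemma poly_above_add:
  fixes f g :: "('n::finite, 'm) coord point \<Rightarrow> real"
  assumes f: "poly_above k S a f" and g: "poly_above k T b g"
  shows "poly_above k (S \<union> T)
    (\<lambda>\<mu> p. (if \<mu> \<in> S then a \<mu> p else 0) + (if \<mu> \<in> T then b \<mu> p else 0)) (\<lambda>p. f p + g p)"
    (is "poly_above k _ (\<lambda>\<mu> p. ?a \<mu> p + ?b \<mu> p) _")
proof -
  have S: "finite S" "finite T" using f g by (auto simp: poly_above_def)
  have a: "smooth_on UNIV UNIV (?a \<mu>)" "depends_only_on (jet_coords k) UNIV (?a \<mu>)" for \<mu>
    using f by (cases "\<mu> \<in> S"; simp add: poly_above_def; simp add: depends_only_on_def)+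
  have b: "smooth_on UNIV UNIV (?b \<mu>)" "depends_only_on (jet_coords k) UNIV (?b \<mu>)" for \<mu>
    using g by (cases "\<mu> \<in> T"; simp add: poly_above_def; simp add: depends_only_on_def)+
  show ?thesis
    unfolding poly_above_def
  proof (intro conjI ballI allI)
    show "finite (S \<union> T)" using S by simp
    fix \<mu>
    show "smooth_on UNIV UNIV (\<lambda>p. ?a \<mu> p + ?b \<mu> p)"
      by (rule smooth_on_add[OF a(1) b(1)])
    show "depends_only_on (jet_coords k) UNIV (\<lambda>p. ?a \<mu> p + ?b \<mu> p)"
      by (rule depends_only_on_binop[OF a(2) b(2)])
  next
    fix \<mu> assume "\<mu> \<in> S \<union> T"
    then show "finite {c. \<mu> c \<noteq> 0}" "{c. \<mu> c \<noteq> 0} \<inter> jet_coords k = {}"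
      using f g by (auto simp: poly_above_def)
  next
    fix p :: "('n, 'm) coord point"
    let ?m = "\<lambda>\<mu> :: ('n, 'm) coord \<Rightarrow> nat. \<Prod>c | \<mu> c \<noteq> 0. p c ^ \<mu> c"
    have "f p = (\<Sum>\<mu>\<in>S. ?a \<mu> p * ?m \<mu>)" "g p = (\<Sum>\<mu>\<in>T. ?b \<mu> p * ?m \<mu>)"
      using f g by (simp_all add: poly_above_def)
    moreover have "(\<Sum>\<mu>\<in>S. ?a \<mu> p * ?m \<mu>) = (\<Sum>\<mu>\<in>S \<union> T. ?a \<mu> p * ?m \<mu>)"
      by (rule sum.mono_neutral_left) (simp_all add: S)
    moreover have "(\<Sum>\<mu>\<in>T. ?b \<mu> p * ?m \<mu>) = (\<Sum>\<mu>\<in>S \<union> T. ?b \<mu> p * ?m \<mu>)"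
      by (rule sum.mono_neutral_left) (simp_all add: S)
    ultimately show "f p + g p = (\<Sum>\<mu>\<in>S \<union> T. (?a \<mu> p + ?b \<mu> p) * ?m \<mu>)"
      by (simp only: distrib_right sum.distrib)
  qed
qed

lemma poly_above_sum:
  assumes "finite I" "\<And>i. i \<in> I \<Longrightarrow> \<exists>S a. poly_above k S a (f i)"
  shows "\<exists>S a. poly_above k S a (\<lambda>p. \<Sum>i\<in>I. f i p)"
  using assms
proof (induction I)
  case empty
  have "poly_above k {} a (\<lambda>_. 0)" for a by (simp add: poly_above_def)
  then show ?case by (simp, blast)
next
  case (insert i I)
  then obtain S a T b where "poly_above k S a (f i)" "poly_above k T b (\<lambda>p. \<Sum>i\<in>I. f i p)"
    by blast
  from poly_above_add[OF this] insert.hyps show ?case by auto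
qed

text \<open>Multiplying two polynomials expands to a double sum over monomials, so closure under finite
  sums and under products of single monomials suffices.\<close>

lemma poly_above_mult:
  assumes f: "poly_above k S a f" and g: "poly_above k T b g"
  shows "\<exists>R c. poly_above k R c (\<lambda>p. f p * g p)"
proof -
  \<comment> \<open>Distinct pairs may have the same exponent sum. Each pair is treated as a
    polynomial of its own, and \<open>poly_above_sum\<close> merges the coefficients.\<close>
  have "\<exists>R c. poly_above k R c
      (\<lambda>p. (a (fst x) p * b (snd x) p) * monomial_at (\<lambda>c. fst x c + snd x c) p)"
    if "x \<in> S \<times> T" for x
  proof (intro exI, rule poly_above_term)
    have x: "fst x \<in> S" "snd x \<in> T" using that by auto
    show "smooth_on UNIV UNIV (\<lambda>p. a (fst x) p * b (snd x) p)"
      using f g x by (simp add: poly_above_def smooth_on_mult)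
    show "depends_only_on (jet_coords k) UNIV (\<lambda>p. a (fst x) p * b (snd x) p)"
      using f g x by (intro depends_only_on_binop[where b = "(*)"]) (auto simp: poly_above_def)
    have "finite {c. fst x c \<noteq> 0}" "finite {c. snd x c \<noteq> 0}"
      "{c. fst x c \<noteq> 0} \<inter> jet_coords k = {}" "{c. snd x c \<noteq> 0} \<inter> jet_coords k = {}"
      using f g x by (simp_all add: poly_above_def)
    moreover have "{c. fst x c + snd x c \<noteq> 0} = {c. fst x c \<noteq> 0} \<union> {c. snd x c \<noteq> 0}" by auto
    ultimately show "finite {c. fst x c + snd x c \<noteq> 0}"
      "{c. fst x c + snd x c \<noteq> 0} \<inter> jet_coords k = {}"
      by (simp_all only: finite_Un Int_Un_distrib2 simp_thms Un_empty)
  qed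
  moreover have "finite (S \<times> T)" using f g by (simp add: poly_above_def)
  ultimately have "\<exists>R c. poly_above k R c (\<lambda>p. \<Sum>x\<in>S \<times> T.
      (a (fst x) p * b (snd x) p) * monomial_at (\<lambda>c. fst x c + snd x c) p)"
    by (intro poly_above_sum) auto
  moreover have "f p * g p = (\<Sum>x\<in>S \<times> T.
      (a (fst x) p * b (snd x) p) * monomial_at (\<lambda>c. fst x c + snd x c) p)" for p
  proof -
    have "(\<Sum>x\<in>S \<times> T. (a (fst x) p * b (snd x) p) * monomial_at (\<lambda>c. fst x c + snd x c) p)
      = (\<Sum>(\<mu>, \<nu>)\<in>S \<times> T. (a \<mu> p * monomial_at \<mu> p) * (b \<nu> p * monomial_at \<nu> p))"
      using f g by (intro sum.cong) (auto simp: poly_above_def monomial_at_add)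
    also have "\<dots> = f p * g p"
      using f g by (simp add: poly_above_def monomial_at_def sum_product sum.cartesian_product)
    finally show ?thesis by simp
  qed
  ultimately show ?thesis by simp
qed

text \<open>Supplies the existence that the definite description in \<open>degree_zero_term\<close>
  needs; uniqueness comes from \<open>poly_above_low_part\<close>.\<close>

lemma jet_poly_poly_above: "f \<in> jet_poly k \<Longrightarrow> \<exists>S a. poly_above k S a f"
proof (induction rule: jet_poly.induct)
  case (base f)
  have "poly_above k {\<lambda>_. 0} (\<lambda>_. f) (\<lambda>p. f p * monomial_at (\<lambda>_. 0) p)"
    by (rule poly_above_term) (use base in auto)
  then show ?case by (auto simp: monomial_at_def)
next
  case (coord c)
  show ?case
  \<comment> \<open>A low coordinate is a coefficient of the monomial 1; a high one is a monomial
    with coefficient 1.\<close>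
  proof (cases "c \<in> jet_coords k")
    case True
    have "poly_above k {\<lambda>_. 0} (\<lambda>_ p. p c) (\<lambda>p. p c * monomial_at (\<lambda>_. 0) p)"
      by (rule poly_above_term) (use True in \<open>auto simp: depends_only_on_def\<close>)
    then show ?thesis by (auto simp: monomial_at_def)
  next
    case False
    have "poly_above k {(\<lambda>_. 0)(c := 1)} (\<lambda>_ _. 1) (\<lambda>p. 1 * monomial_at ((\<lambda>_. 0)(c := 1)) p)"
      by (rule poly_above_term) (use False in \<open>auto simp: depends_only_on_def\<close>)
    moreover have "monomial_at ((\<lambda>_. 0)(c := 1)) p = p c" for p
    proof -
      have "{d. ((\<lambda>_. 0::nat)(c := 1)) d \<noteq> 0} = {c}" by auto
      then show ?thesis by (simp only: monomial_at_def) simp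
    qed
    ultimately show ?thesis by (auto simp del: fun_upd_apply)
  qed
next
  case (add f g)
  then show ?case using poly_above_add by blast
next
  case (mult f g)
  then show ?case using poly_above_mult by blast
qed

definition low_part :: "nat \<Rightarrow> ('n::finite, 'm) coord point \<Rightarrow> ('n, 'm) coord point" where
  "low_part k p = (\<lambda>c. if c \<in> jet_coords k then p c else 0)"

text \<open>Setting the high coordinates to 0 leaves the coefficients alone and kills every monomial
  of positive degree. The right-hand side mentions neither S nor \<open>a\<close>, so all expansions
  of f have the same term of degree zero.\<close>

lemma poly_above_low_part:
  assumes "poly_above k S a f"
  shows "(\<Sum>\<mu> | \<mu> \<in> S \<and> (\<Sum>c | \<mu> c \<noteq> 0. \<mu> c) = 0. a \<mu> p) = f (low_part k p)"
proof -
  have S: "finite S" and fin: "\<And>\<mu>. \<mu> \<in> S \<Longrightarrow> finite {c. \<mu> c \<noteq> 0}"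
    and disj: "\<And>\<mu>. \<mu> \<in> S \<Longrightarrow> {c. \<mu> c \<noteq> 0} \<inter> jet_coords k = {}"
    and dep: "\<And>\<mu>. \<mu> \<in> S \<Longrightarrow> depends_only_on (jet_coords k) UNIV (a \<mu>)"
    and f: "\<And>p. f p = (\<Sum>\<mu>\<in>S. a \<mu> p * monomial_at \<mu> p)"
    using assms by (auto simp: poly_above_def monomial_at_def)
  have a: "a \<mu> (low_part k p) = a \<mu> p" if "\<mu> \<in> S" for \<mu>
    using dep[OF that] by (auto simp: depends_only_on_def low_part_def)
  \<comment> \<open>Finite support matters here: a sum over an infinite set is 0 by convention, so
    an infinite support would pass for degree zero.\<close>
  have zero: "(\<Sum>c | \<mu> c \<noteq> 0. \<mu> c) = 0 \<longleftrightarrow> {c. \<mu> c \<noteq> 0} = {}" if "\<mu> \<in> S" for \<mu>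
    using fin[OF that] by auto
  have "f (low_part k p) = (\<Sum>\<mu>\<in>S. a \<mu> p * monomial_at \<mu> (low_part k p))"
    by (simp add: f a)
  also have "\<dots> = (\<Sum>\<mu> | \<mu> \<in> S \<and> (\<Sum>c | \<mu> c \<noteq> 0. \<mu> c) = 0. a \<mu> p * monomial_at \<mu> (low_part k p))"
  proof (rule sum.mono_neutral_right[OF S])
    show "\<forall>\<mu>\<in>S - {\<mu> \<in> S. (\<Sum>c | \<mu> c \<noteq> 0. \<mu> c) = 0}. a \<mu> p * monomial_at \<mu> (low_part k p) = 0"
    proof
      fix \<mu> assume \<mu>: "\<mu> \<in> S - {\<mu> \<in> S. (\<Sum>c | \<mu> c \<noteq> 0. \<mu> c) = 0}"
      then obtain d where d: "\<mu> d \<noteq> 0" using zero by blast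
      then have "low_part k p d ^ \<mu> d = 0" using disj[of \<mu>] \<mu> by (auto simp: low_part_def)
      then have "monomial_at \<mu> (low_part k p) = 0"
        unfolding monomial_at_def using \<mu> d fin[of \<mu>] by (intro prod_zero) auto
      then show "a \<mu> p * monomial_at \<mu> (low_part k p) = 0" by simp
    qed
  qed auto
  also have "\<dots> = (\<Sum>\<mu> | \<mu> \<in> S \<and> (\<Sum>c | \<mu> c \<noteq> 0. \<mu> c) = 0. a \<mu> p)"
  proof (rule sum.cong[OF refl])
    fix \<mu> assume "\<mu> \<in> {\<mu> \<in> S. (\<Sum>c | \<mu> c \<noteq> 0. \<mu> c) = 0}"
    then have "{c. \<mu> c \<noteq> 0} = {}" using zero by blast
    then show "a \<mu> p * monomial_at \<mu> (low_part k p) = a \<mu> p"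
      unfolding monomial_at_def by (simp only: prod.empty mult_1_right)
  qed
  finally show ?thesis by simp
qed

lemma degree_zero_term_eq:
  assumes "f \<in> jet_poly k"
  shows "degree_zero_term k f = (\<lambda>p. f (low_part k p))"
  unfolding degree_zero_term_def
proof (rule the_equality)
  obtain S a where *: "poly_above k S a f" using jet_poly_poly_above[OF assms] by blast
  show "\<exists>S a. poly_above k S a f \<and> (\<lambda>p. f (low_part k p)) =
      (\<lambda>p. \<Sum>\<mu> | \<mu> \<in> S \<and> (\<Sum>c | \<mu> c \<noteq> 0. \<mu> c) = 0. a \<mu> p)"
    by (rule exI[of _ S], rule exI[of _ a]) (simp only: * poly_above_low_part[OF *] simp_thms)
next
  fix g
  assume "\<exists>S a. poly_above k S a f \<and>
    g = (\<lambda>p. \<Sum>\<mu> | \<mu> \<in> S \<and> (\<Sum>c | \<mu> c \<noteq> 0. \<mu> c) = 0. a \<mu> p)"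
  then obtain S a where "poly_above k S a f"
    and g: "g = (\<lambda>p. \<Sum>\<mu> | \<mu> \<in> S \<and> (\<Sum>c | \<mu> c \<noteq> 0. \<mu> c) = 0. a \<mu> p)"
    by blast
  then show "g = (\<lambda>p. f (low_part k p))"
    by (simp only: poly_above_low_part)
qed

text \<open>The coefficients not truncated do not see the high coordinates, and for the others the
  term of degree zero is evaluation with these set to 0. \<open>low_part\<close> also discards the
  value \<open>undefined\<close> that a point of the k-jet space takes outside
  \<open>jet_coords k\<close>.\<close>

lemma truncated_field_eq:
  assumes "lie_backlund V"
    and XC: "\<And>i. depends_only_on (jet_coords k) UNIV (\<lambda>p. V p (XC i))"
    and YC: "\<And>L. depends_only_on (jet_coords k) UNIV (\<lambda>p. V p (YC L (\<lambda>_. 0)))"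
  shows "truncated_field k V q c = V (low_part k q) c"
proof (cases c)
  case (XC i)
  then show ?thesis
    using assms(2)[of i] by (auto simp: truncated_field_def depends_only_on_def low_part_def)
next
  case (YC L \<alpha>)
  show ?thesis
  proof (cases "msize \<alpha> = 0")
    case True
    then have "\<alpha> = (\<lambda>_. 0)" by (auto simp: msize_def)
    then show ?thesis
      using assms(3)[of L] YC True
      by (auto simp: truncated_field_def depends_only_on_def low_part_def)
  next
    case False
    then show ?thesis
      using degree_zero_term_eq[OF lie_backlund_jet_poly[OF assms, of c]] YC
      by (simp add: truncated_field_def)
  qed
qed

subsection \<open>The chain rule for functions of finitely many coordinates\<close>

lemma tendsto_componentwiseI:
  fixes \<gamma> :: "'a \<Rightarrow> 'c \<Rightarrow> 'b::topological_space"
  assumes "\<And>c. ((\<lambda>s. \<gamma> s c) \<longlongrightarrow> l c) F"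
  shows "(\<gamma> \<longlongrightarrow> l) F"
  using limitin_componentwise[of "\<lambda>_. euclidean" UNIV \<gamma> l F] assms
  by (simp add: euclidean_product_topology)

lemma continuous_on_open_tendsto:
  assumes "open S" "continuous_on S f" "p \<in> S"
  shows "(f \<longlongrightarrow> f p) (nhds p)"
proof (rule topological_tendstoI)
  fix B assume "open B" "f p \<in> B"
  then obtain A where "open A" "p \<in> A" "\<forall>y\<in>S. y \<in> A \<longrightarrow> f y \<in> B"
    using assms(2,3) unfolding continuous_on_topological by blast
  then show "\<forall>\<^sub>F x in nhds p. f x \<in> B"
    unfolding eventually_nhds using assms(1,3) by (intro exI[of _ "A \<inter> S"]) auto
qed

text \<open>Here b may lie on either side of a or equal it. The bound on \<xi> later forces \<xi> to
  converge to a as b does.\<close>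

lemma mvt_between:
  fixes g :: "real \<Rightarrow> real"
  assumes "\<And>h. \<bar>h - a\<bar> \<le> \<bar>b - a\<bar> \<Longrightarrow> (g has_real_derivative g' h) (at h)"
  shows "\<exists>\<xi>. \<bar>\<xi> - a\<bar> \<le> \<bar>b - a\<bar> \<and> g b - g a = (b - a) * g' \<xi>"
proof -
  consider "a < b" | "b < a" | "a = b" by linarith
  then show ?thesis
  proof cases
    case 1
    then have "\<exists>z. a < z \<and> z < b \<and> g b - g a = (b - a) * g' z"
      by (intro MVT2) (auto intro: assms)
    then show ?thesis by force
  next
    case 2
    then have "\<exists>z. b < z \<and> z < a \<and> g a - g b = (a - b) * g' z"
      by (intro MVT2) (auto intro: assms)
    then obtain z where "b < z" "z < a" "g a - g b = (a - b) * g' z" by blast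
    then show ?thesis by (intro exI[of _ z]) (auto simp: algebra_simps)
  qed auto
qed

text \<open>The product topology on infinitely many coordinates comes from no norm, so the classical
  argument by coordinates is used: change one coordinate at a time, apply the mean value theorem to
  each increment, and pass to the limit by continuity of the partials.\<close>

lemma chain_rule_coordinates:
  fixes f :: "'c point \<Rightarrow> real" and \<gamma> :: "real \<Rightarrow> 'c point"
  assumes S: "open S" and F: "finite F" "depends_only_on F S f"
    and D: "\<And>c p. p \<in> S \<Longrightarrow> ((\<lambda>h. f (p(c := h))) has_real_derivative f' c p) (at (p c))"
    and cont: "\<And>c. continuous_on S (f' c)"
    and \<gamma>: "\<And>c. ((\<lambda>s. \<gamma> s c) has_real_derivative \<gamma>' c) (at s0)"
    and s0: "\<gamma> s0 \<in> S"
  shows "((\<lambda>s. f (\<gamma> s)) has_real_derivative (\<Sum>c\<in>F. f' c (\<gamma> s0) * \<gamma>' c)) (at s0)"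
proof -
  \<comment> \<open>As E grows from the empty set to F, \<open>\<delta> E s\<close> passes from
    \<open>\<gamma> s0\<close> to a point that agrees with \<open>\<gamma> s\<close> on F.\<close>
  define \<delta> where "\<delta> E s = (\<lambda>c. if c \<in> E then \<gamma> s c else \<gamma> s0 c)" for E s
  have \<gamma>_lim: "((\<lambda>s. \<gamma> s c) \<longlongrightarrow> \<gamma> s0 c) (nhds s0)" for c
    using DERIV_isCont[OF \<gamma>, of c] tendsto_at_iff_tendsto_nhds[of "\<lambda>s. \<gamma> s c" s0]
    by (simp add: isCont_def)
  have \<delta>_lim: "((\<lambda>s. \<delta> E s c) \<longlongrightarrow> \<gamma> s0 c) (nhds s0)" for E c
    using \<gamma>_lim[of c] by (cases "c \<in> E") (simp_all add: \<delta>_def)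
  have f'_lim: "(f' c \<longlongrightarrow> f' c (\<gamma> s0)) (nhds (\<gamma> s0))" for c
    by (rule continuous_on_open_tendsto[OF S cont s0])
  have "((\<lambda>s. f (\<delta> E s)) has_real_derivative (\<Sum>c\<in>E. f' c (\<gamma> s0) * \<gamma>' c)) (at s0)"
    if "finite E" for E
    using that
  proof (induction E)
    case empty
    show ?case by (simp add: \<delta>_def)
  next
    case (insert c E)
    define a where "a = \<gamma> s0 c"
    define d where "d s = f (\<delta> (insert c E) s) - f (\<delta> E s)" for s
    have upd: "\<delta> (insert c E) s = (\<delta> E s)(c := \<gamma> s c)" "\<delta> E s = (\<delta> E s)(c := a)" for s
      using insert.hyps by (auto simp: \<delta>_def a_def)
    \<comment> \<open>The limit is joint in s and h because the mean value theorem needs the whole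
      segment between a and \<open>\<gamma> s c\<close> to stay in S.\<close>
    have "((\<lambda>(s, h). (\<delta> E s)(c := h)) \<longlongrightarrow> \<gamma> s0) (nhds s0 \<times>\<^sub>F nhds a)"
    proof (rule tendsto_componentwiseI)
      fix e
      have "((\<lambda>x. \<delta> E (fst x) e) \<longlongrightarrow> \<gamma> s0 e) (nhds s0 \<times>\<^sub>F nhds a)"
        by (rule filterlim_compose[OF \<delta>_lim filterlim_fst])
      moreover have "(snd \<longlongrightarrow> a) (nhds s0 \<times>\<^sub>F nhds a)"
        by (rule filterlim_snd)
      ultimately show "((\<lambda>x. (case x of (s, h) \<Rightarrow> (\<delta> E s)(c := h)) e) \<longlongrightarrow> \<gamma> s0 e) (nhds s0 \<times>\<^sub>F nhds a)"
        by (cases "e = c") (simp_all add: case_prod_unfold a_def)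
    qed
    then have "\<forall>\<^sub>F (s, h) in nhds s0 \<times>\<^sub>F nhds a. (\<delta> E s)(c := h) \<in> S"
      using topological_tendstoD[OF _ S s0] by (force simp: case_prod_unfold)
    then obtain P Q where P: "eventually P (nhds s0)" and Q: "eventually Q (nhds a)"
      and PQ: "\<And>s h. P s \<Longrightarrow> Q h \<Longrightarrow> (\<delta> E s)(c := h) \<in> S"
      unfolding eventually_prod_filter by blast
    obtain e where e: "e > 0" "\<And>h. dist h a < e \<Longrightarrow> Q h"
      using Q unfolding eventually_nhds_metric by blast
    have "\<forall>\<^sub>F s in nhds s0. dist (\<gamma> s c) a < e"
      using tendstoD[OF \<gamma>_lim e(1)] by (simp add: a_def)
    with P have "\<forall>\<^sub>F s in nhds s0. \<exists>\<xi>. \<bar>\<xi> - a\<bar> \<le> \<bar>\<gamma> s c - a\<bar> \<and>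
        d s = (\<gamma> s c - a) * f' c ((\<delta> E s)(c := \<xi>))"
    proof eventually_elim
      case (elim s)
      have "((\<lambda>h. f ((\<delta> E s)(c := h))) has_real_derivative f' c ((\<delta> E s)(c := h))) (at h)"
        if "\<bar>h - a\<bar> \<le> \<bar>\<gamma> s c - a\<bar>" for h
      proof -
        have "(\<delta> E s)(c := h) \<in> S"
          using that elim by (intro PQ e) (auto simp: dist_real_def)
        from D[OF this, of c] show ?thesis by simp
      qed
      from mvt_between[of a "\<gamma> s c", OF this] show ?case
        unfolding d_def upd(1)[of s] using upd(2)[of s] by simp
    qed
    then obtain \<xi> where \<xi>: "\<forall>\<^sub>F s in nhds s0. \<bar>\<xi> s - a\<bar> \<le> \<bar>\<gamma> s c - a\<bar> \<and>
        d s = (\<gamma> s c - a) * f' c ((\<delta> E s)(c := \<xi> s))"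
      unfolding eventually_ex by blast
    have "((\<lambda>s. \<xi> s - a) \<longlongrightarrow> 0) (nhds s0)"
    proof (rule Lim_null_comparison)
      show "\<forall>\<^sub>F s in nhds s0. norm (\<xi> s - a) \<le> \<bar>\<gamma> s c - a\<bar>"
        using \<xi> by eventually_elim simp
      show "((\<lambda>s. \<bar>\<gamma> s c - a\<bar>) \<longlongrightarrow> 0) (nhds s0)"
        using \<gamma>_lim[of c] by (intro tendsto_rabs_zero) (simp add: a_def LIM_zero)
    qed
    then have \<xi>_lim: "(\<xi> \<longlongrightarrow> a) (nhds s0)"
      by (rule LIM_zero_cancel)
    have "((\<lambda>s. (\<delta> E s)(c := \<xi> s)) \<longlongrightarrow> \<gamma> s0) (nhds s0)"
    proof (rule tendsto_componentwiseI)
      show "((\<lambda>s. ((\<delta> E s)(c := \<xi> s)) e) \<longlongrightarrow> \<gamma> s0 e) (nhds s0)" for e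
        using \<xi>_lim \<delta>_lim by (cases "e = c") (simp_all add: a_def)
    qed
    then have "((\<lambda>s. f' c ((\<delta> E s)(c := \<xi> s))) \<longlongrightarrow> f' c (\<gamma> s0)) (at s0)"
      using filterlim_compose[OF f'_lim] tendsto_mono[OF at_within_le_nhds] by blast
    moreover have "((\<lambda>s. (\<gamma> s c - a) / (s - s0)) \<longlongrightarrow> \<gamma>' c) (at s0)"
      using \<gamma>[of c] unfolding has_field_derivative_iff a_def .
    ultimately have "((\<lambda>s. f' c ((\<delta> E s)(c := \<xi> s)) * ((\<gamma> s c - a) / (s - s0)))
        \<longlongrightarrow> f' c (\<gamma> s0) * \<gamma>' c) (at s0)"
      by (rule tendsto_mult)
    moreover have "\<forall>\<^sub>F s in at s0. f' c ((\<delta> E s)(c := \<xi> s)) * ((\<gamma> s c - a) / (s - s0)) =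
        (d s - d s0) / (s - s0)"
    proof -
      have "\<forall>\<^sub>F s in at s0. d s = (\<gamma> s c - a) * f' c ((\<delta> E s)(c := \<xi> s))"
        using filter_leD[OF at_within_le_nhds \<xi>] by (rule eventually_mono) simp
      moreover have "d s0 = 0" by (simp add: d_def \<delta>_def)
      ultimately show ?thesis by (auto elim!: eventually_mono)
    qed
    ultimately have "(d has_real_derivative f' c (\<gamma> s0) * \<gamma>' c) (at s0)"
      unfolding has_field_derivative_iff by (rule Lim_transform_eventually)
    from DERIV_add[OF this insert.IH] show ?case
      using insert.hyps by (simp add: d_def)
  qed
  from this[OF F(1)] have "((\<lambda>s. f (\<delta> F s)) has_real_derivative
      (\<Sum>c\<in>F. f' c (\<gamma> s0) * \<gamma>' c)) (at s0)" .
  \<comment> \<open>Agreement on F decides the value of f only for points of S, so both points must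
    first be brought into S.\<close>
  moreover have "\<forall>\<^sub>F s in nhds s0. f (\<delta> F s) = f (\<gamma> s)"
  proof -
    have "\<forall>\<^sub>F s in nhds s0. \<delta> F s \<in> S"
      by (rule topological_tendstoD[OF tendsto_componentwiseI[OF \<delta>_lim] S s0])
    moreover have "\<forall>\<^sub>F s in nhds s0. \<gamma> s \<in> S"
      by (rule topological_tendstoD[OF tendsto_componentwiseI[OF \<gamma>_lim] S s0])
    ultimately show ?thesis
      by eventually_elim (rule depends_only_onD[OF F(2)], auto simp: \<delta>_def)
  qed
  ultimately show ?thesis
    using DERIV_cong_ev[of s0 s0 "\<lambda>s. f (\<delta> F s)" "\<lambda>s. f (\<gamma> s)"] by blast
qed

text \<open>A coordinate line may leave S, so the slices through p and q are controlled only near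
  the base point; the derivative needs no more. This keeps the partials of a flow component fixed
  while high coordinates are scaled.\<close>

lemma partial_cong_depends_only_on:
  assumes S: "open S" and f: "depends_only_on F S f"
    and pq: "p \<in> S" "q \<in> S" "\<And>c. c \<in> F \<Longrightarrow> p c = q c"
  shows "partial c f p = partial c f q"
proof -
  have near: "\<forall>\<^sub>F h in nhds (r c). r(c := h) \<in> S" if "r \<in> S" for r
  proof -
    have "((\<lambda>h. r(c := h)) \<longlongrightarrow> r) (nhds (r c))"
    proof (rule tendsto_componentwiseI)
      show "((\<lambda>h. (r(c := h)) d) \<longlongrightarrow> r d) (nhds (r c))" for d
        by (cases "d = c") (auto simp: filterlim_ident)
    qed
    from topological_tendstoD[OF this S that] show ?thesis .
  qed
  show ?thesis
  proof (cases "c \<in> F")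
    case True
    then have c: "p c = q c" by (rule pq(3))
    have "\<forall>\<^sub>F h in nhds (p c). f (p(c := h)) = f (q(c := h))"
      using near[OF pq(1)] near[OF pq(2)] unfolding c
      by eventually_elim (rule depends_only_onD[OF f], auto simp: pq(3))
    then show ?thesis unfolding partial_def using c by (intro deriv_cong_ev)
  next
    case False
    have "partial c f r = 0" if r: "r \<in> S" for r
    proof -
      have "\<forall>\<^sub>F h in nhds (r c). f (r(c := h)) = f r"
        using near[OF r] by eventually_elim (rule depends_only_onD[OF f], use r False in auto)
      then have "partial c f r = deriv (\<lambda>_. f r) (r c)"
        unfolding partial_def by (intro deriv_cong_ev refl)
      then show ?thesis by simp
    qed
    with pq show ?thesis by simp
  qed
qed

subsection \<open>Local flows\<close>

text \<open>Product neighbourhoods let point and time vary independently: later the point is scaled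
  at a fixed time, or moves while the time is t - s.\<close>

lemma eventually_nhds_box:
  fixes p :: "'a::topological_space"
  assumes "\<forall>\<^sub>F (q, t) in nhds (p, 0::real). P q t"
  obtains N e where "open N" "p \<in> N" "e > 0" "\<forall>q\<in>N. \<forall>t. \<bar>t\<bar> < e \<longrightarrow> P q t"
proof -
  obtain Q R where Q: "eventually Q (nhds p)" and R: "eventually R (nhds (0::real))"
    and P: "\<And>q t. Q q \<Longrightarrow> R t \<Longrightarrow> P q t"
    using assms unfolding nhds_prod eventually_prod_filter by auto
  obtain N where "open N" "p \<in> N" "\<And>q. q \<in> N \<Longrightarrow> Q q"
    using Q unfolding eventually_nhds by blast
  moreover obtain e where "e > 0" "\<And>t. dist t 0 < e \<Longrightarrow> R t"
    using R unfolding eventually_nhds_metric by blast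
  ultimately show thesis by (intro that[of N e]) (auto simp: dist_real_def intro: P)
qed

lemma eventually_nhds_box2:
  fixes p :: "'a::topological_space"
  assumes "\<forall>\<^sub>F (q, s, t) in nhds (p, 0::real, 0::real). P q s t"
  obtains N e where "open N" "p \<in> N" "e > 0"
    "\<forall>q\<in>N. \<forall>s t. \<bar>s\<bar> < e \<longrightarrow> \<bar>t\<bar> < e \<longrightarrow> P q s t"
proof -
  obtain Q R where Q: "eventually Q (nhds p)" and R: "eventually R (nhds (0::real, 0::real))"
    and P: "\<And>q x. Q q \<Longrightarrow> R x \<Longrightarrow> P q (fst x) (snd x)"
    using assms unfolding nhds_prod[of p] eventually_prod_filter by (auto simp: case_prod_unfold)
  obtain N where N: "open N" "p \<in> N" "\<And>q. q \<in> N \<Longrightarrow> Q q"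
    using Q unfolding eventually_nhds by blast
  have "\<forall>\<^sub>F (s, t) in nhds (0, 0). R (s, t)" using R by simp
  then obtain N' e where "open N'" "0 \<in> N'" "e > 0"
    and e: "\<forall>s\<in>N'. \<forall>t. \<bar>t\<bar> < e \<longrightarrow> R (s, t)"
    by (rule eventually_nhds_box)
  moreover obtain d where "d > 0" and d: "\<And>s. dist s 0 < d \<Longrightarrow> s \<in> N'"
    using calculation unfolding open_dist by blast
  moreover have "P q s t" if "q \<in> N" "\<bar>s\<bar> < min d e" "\<bar>t\<bar> < min d e" for q s t
    using that P[OF N(3), of q "(s, t)"] d[of s] e by simp
  ultimately show thesis
    using N(1,2) by (intro that[of N "min d e"]) auto
qed

text \<open>Pulling back along restriction carries open sets and continuity from
  \<open>space_of A\<close> to the topology of the type, where \<open>nhds\<close> and limits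
  apply.\<close>

lemma continuous_map_restrict_point:
  "continuous_map euclidean (space_of A) (\<lambda>q. restrict q A)"
  unfolding continuous_map_componentwise by auto

lemma continuous_map_restrict_pair:
  "continuous_map euclidean (prod_topology (space_of A) euclidean)
    (\<lambda>x :: 'c point \<times> 'b::topological_space. (restrict (fst x) A, snd x))"
proof (intro continuous_map_pairedI)
  have "continuous_map euclidean euclidean (fst :: 'c point \<times> 'b \<Rightarrow> _)"
    by (simp add: continuous_on_fst)
  from continuous_map_compose[OF this continuous_map_restrict_point[of A]]
  show "continuous_map euclidean (space_of A) (\<lambda>x :: 'c point \<times> 'b. restrict (fst x) A)"
    by (simp add: o_def)
qed (simp add: continuous_on_snd)

lemma open_flow_domain:
  assumes "local_flow A V U W \<Phi>"
  shows "open {(q, t). (restrict q A, t) \<in> W}"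
proof -
  have "openin (prod_topology (space_of A) euclideanreal) W"
    using assms by (simp add: local_flow_def)
  from openin_continuous_map_preimage[OF continuous_map_restrict_pair this]
  show ?thesis by (simp add: case_prod_unfold)
qed

lemma open_initial_points:
  assumes "local_flow A V U W \<Phi>"
  shows "open {q. restrict q A \<in> U}"
proof -
  have "openin (space_of A) U"
    using assms by (simp add: local_flow_def)
  from openin_continuous_map_preimage[OF continuous_map_restrict_point this]
  show ?thesis by simp
qed

lemma local_flow_group:
  assumes fl: "local_flow A V U W \<Phi>" and p: "restrict p A \<in> U"
  obtains N e where "open N" "p \<in> N" "e > 0"
    "\<forall>q\<in>N. \<forall>s t. \<bar>s\<bar> < e \<longrightarrow> \<bar>t\<bar> < e \<longrightarrow>
      \<Phi> t (\<Phi> s (restrict q A)) = \<Phi> (t + s) (restrict q A)"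
proof -
  let ?X = "prod_topology (space_of A) (prod_topology euclideanreal euclideanreal)"
  have "\<forall>\<^sub>F (q, s, t) in nhdsin ?X (restrict p A, 0, 0). \<Phi> t (\<Phi> s q) = \<Phi> (t + s) q"
    using fl p by (simp add: local_flow_def)
  moreover have "(restrict p A, 0, 0) \<in> topspace ?X" by simp
  ultimately obtain O' where O': "openin ?X O'" "(restrict p A, 0, 0) \<in> O'"
    "\<forall>(q, s, t)\<in>O'. \<Phi> t (\<Phi> s q) = \<Phi> (t + s) q"
    unfolding eventually_nhdsin by blast
  have "openin (prod_topology (space_of A) (euclidean :: (real \<times> real) topology)) O'"
    using O'(1) by simp
  from openin_continuous_map_preimage[OF continuous_map_restrict_pair this]
  have "open {x. (restrict (fst x) A, snd x) \<in> O'}" by simp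
  then have "\<forall>\<^sub>F (q, s, t) in nhds (p, 0, 0).
      \<Phi> t (\<Phi> s (restrict q A)) = \<Phi> (t + s) (restrict q A)"
    unfolding eventually_nhds using O' by (intro exI[of _ "{x. (restrict (fst x) A, snd x) \<in> O'}"]) auto
  then show thesis by (rule eventually_nhds_box2) (rule that)
qed

lemma local_flow_continuous:
  assumes fl: "local_flow A V U W \<Phi>" and c: "c \<in> A"
  shows "continuous_on {(q, t). (restrict q A, t) \<in> W} (\<lambda>(q, t). \<Phi> t (restrict q A) c)"
proof -
  let ?B = "insert None (Some ` A)"
  let ?S = "{z \<in> topspace (space_of ?B). (z \<circ> Some, z None) \<in> W}"
  let ?D = "{x. (restrict (fst x) A, snd x) \<in> W}"
  \<comment> \<open>Repacks a point and a time as a point of the coordinate set in which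
    \<open>local_flow\<close> states smoothness, with time at \<open>None\<close>.\<close>
  define m where "m x = restrict (case_option (snd x) (fst x)) ?B" for x :: "'a point \<times> real"
  have m_Some: "m x \<circ> Some = restrict (fst x) A" and m_None: "m x None = snd x" for x
    by (auto simp: m_def fun_eq_iff)
  have "smooth_on ?B ?S (\<lambda>z. \<Phi> (z None) (z \<circ> Some) c)"
    using fl c by (simp add: local_flow_def)
  then have "continuous_map (subtopology (space_of ?B) ?S) euclideanreal
      (foldr partial [] (\<lambda>z. \<Phi> (z None) (z \<circ> Some) c))"
    unfolding smooth_on_def by (meson lists.Nil)
  then have cont: "continuous_map (subtopology (space_of ?B) ?S) euclideanreal
      (\<lambda>z. \<Phi> (z None) (z \<circ> Some) c)" by simp
  have "continuous_map euclidean (space_of ?B) m"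
    unfolding continuous_map_componentwise
  proof (intro conjI ballI)
    show "m ` topspace euclidean \<subseteq> extensional ?B" by (auto simp: m_def)
    fix d assume "d \<in> ?B"
    then show "continuous_map euclidean euclideanreal (\<lambda>x. m x d)"
      by (auto simp: m_def intro!: continuous_on_snd continuous_on_id
          continuous_on_product_then_coordinatewise[OF continuous_on_fst])
  qed
  moreover have "m ` ?D \<subseteq> ?S"
  proof clarify
    fix q :: "'a point" and t assume "(restrict (fst (q, t)) A, snd (q, t)) \<in> W"
    moreover have "m (q, t) \<in> topspace (space_of ?B)" by (simp add: m_def)
    ultimately show "m (q, t) \<in> topspace (space_of ?B) \<and> (m (q, t) \<circ> Some, m (q, t) None) \<in> W"
      by (simp only: m_Some m_None)
  qed
  ultimately have "continuous_map (subtopology euclidean ?D) (subtopology (space_of ?B) ?S) m"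
    by (simp add: continuous_map_in_subtopology continuous_map_from_subtopology image_subset_iff_funcset)
  from continuous_map_compose[OF this cont]
  have "continuous_on ?D (\<lambda>x. \<Phi> (snd x) (restrict (fst x) A) c)"
    by (simp add: o_def m_Some[unfolded o_def] m_None)
  then show ?thesis by (simp add: case_prod_unfold)
qed

text \<open>Freezing the coordinates outside A lifts a flow on the k-jet space to curves in the full
  jet space, where \<Phi> can be evaluated along them.\<close>

lemma local_flow_tendsto:
  assumes fl: "local_flow A V U W \<Phi>" and p: "restrict p A \<in> U"
  shows "((\<lambda>(q, t) c. if c \<in> A then \<Phi> t (restrict q A) c else q c) \<longlongrightarrow> p) (nhds (p, 0))"
proof (rule tendsto_componentwiseI)
  fix c
  let ?D = "{(q, t). (restrict q A, t) \<in> W}"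
  have D: "open ?D" "(p, 0) \<in> ?D"
    using open_flow_domain[OF fl] fl p by (auto simp: local_flow_def)
  show "((\<lambda>x. (case x of (q, t) \<Rightarrow> \<lambda>c. if c \<in> A then \<Phi> t (restrict q A) c else q c) c) \<longlongrightarrow> p c)
      (nhds (p, 0))"
  proof (cases "c \<in> A")
    case True
    have "((\<lambda>(q, t). \<Phi> t (restrict q A) c) \<longlongrightarrow> \<Phi> 0 (restrict p A) c) (nhds (p, 0))"
      using continuous_on_open_tendsto[OF D(1) local_flow_continuous[OF fl True] D(2)] by simp
    moreover have "\<Phi> 0 (restrict p A) c = p c"
      using fl p True by (simp add: local_flow_def)
    ultimately show ?thesis using True by (simp add: case_prod_unfold)
  next
    case False
    have "continuous_on UNIV (\<lambda>x :: 'a point \<times> real. fst x c)"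
      by (intro continuous_on_product_then_coordinatewise[OF continuous_on_fst] continuous_on_id)
    then have "((\<lambda>x :: 'a point \<times> real. fst x c) \<longlongrightarrow> fst (p, 0::real) c) (nhds (p, 0))"
      by (intro continuous_on_open_tendsto[OF open_UNIV]) simp_all
    then show ?thesis using False by (simp add: case_prod_unfold)
  qed
qed

text \<open>\<open>local_flow\<close> gives the derivative only at time 0. The group law moves it to
  time t, provided that the point reached at time t is again in U, which holds near (p, 0) by
  continuity.\<close>

lemma local_flow_ode:
  assumes fl: "local_flow A V U W \<Phi>" and p: "restrict p A \<in> U"
  shows "\<forall>\<^sub>F (q, t) in nhds (p, 0). \<forall>c\<in>A.
    ((\<lambda>s. \<Phi> s (restrict q A) c) has_real_derivative V (\<Phi> t (restrict q A)) c) (at t)"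
proof -
  let ?e = "\<lambda>(q, t) c. if c \<in> A then \<Phi> t (restrict q A) c else q c"
  obtain N e where N: "open N" "p \<in> N" "e > 0" and
    group: "\<forall>q\<in>N. \<forall>s t. \<bar>s\<bar> < e \<longrightarrow> \<bar>t\<bar> < e \<longrightarrow>
      \<Phi> t (\<Phi> s (restrict q A)) = \<Phi> (t + s) (restrict q A)"
    by (rule local_flow_group[OF fl p])
  have "open (N \<times> {-e<..<e})" using N(1) by (intro open_Times) auto
  then have "\<forall>\<^sub>F x in nhds (p, 0). x \<in> N \<times> {-e<..<e}"
    using N by (intro eventually_nhds_in_open) auto
  moreover have "\<forall>\<^sub>F x in nhds (p, 0). ?e x \<in> {q. restrict q A \<in> U}"
    using topological_tendstoD[OF local_flow_tendsto[OF fl p] open_initial_points[OF fl]] p by simp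
  moreover have "\<forall>\<^sub>F x in nhds (p, 0). x \<in> {(q, t). (restrict q A, t) \<in> W}"
    using open_flow_domain[OF fl] fl p by (intro eventually_nhds_in_open) (auto simp: local_flow_def)
  ultimately show ?thesis
  proof eventually_elim
    case (elim x)
    obtain q t where x: "x = (q, t)" by force
    define r where "r = \<Phi> t (restrict q A)"
    have q: "q \<in> N" and t: "\<bar>t\<bar> < e" using elim(1) x by auto
    \<comment> \<open>Extensionality of r recovers it as the restriction of its lift
      \<open>?e x\<close>, which is known to restrict into U.\<close>
    have "r \<in> topspace (space_of A)"
      using elim(3) fl x by (auto simp: local_flow_def r_def)
    then have "restrict (?e x) A = r"
      by (auto simp: x r_def PiE_def extensional_def fun_eq_iff)
    then have r: "r \<in> U" using elim(2) by simp
    have "((\<lambda>s. \<Phi> s (restrict q A) c) has_real_derivative V r c) (at t)" if "c \<in> A" for c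
    proof -
      have "((\<lambda>h. \<Phi> h r c) has_real_derivative V r c) (at 0)"
        using fl r that by (simp add: local_flow_def)
      moreover have "\<forall>\<^sub>F h in nhds 0. \<Phi> h r c = \<Phi> (h + t) (restrict q A) c"
        unfolding eventually_nhds_metric
        using N(3) group q t by (intro exI[of _ e]) (auto simp: r_def)
      ultimately have "((\<lambda>h. \<Phi> (h + t) (restrict q A) c) has_real_derivative V r c) (at 0)"
        using DERIV_cong_ev[of 0 0 "\<lambda>h. \<Phi> h r c" "\<lambda>h. \<Phi> (h + t) (restrict q A) c" "V r c"] by simp
      then show ?thesis
        using DERIV_shift[of "\<lambda>s. \<Phi> s (restrict q A) c" "V r c" 0 t] by simp
    qed
    then show ?case by (simp add: x r_def)
  qed
qed

subsection \<open>Components of the flow of a Lie-Baecklund field\<close>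

text \<open>Time becomes one more coordinate, so that a single chain rule covers the time and space
  partials.\<close>

definition flow_component ::
  "(real \<Rightarrow> 'c point \<Rightarrow> 'c point) \<Rightarrow> 'c \<Rightarrow> 'c option point \<Rightarrow> real" where
  "flow_component \<Phi> c z = \<Phi> (z None) (z \<circ> Some) c"

definition space_time :: "('c point \<times> real) set \<Rightarrow> 'c option point set" where
  "space_time W = {z. (z \<circ> Some, z None) \<in> W}"

lemma flow_component_case_option [simp]: "flow_component \<Phi> c (case_option t q) = \<Phi> t q c"
  by (simp add: flow_component_def o_def)

lemma case_option_in_space_time [simp]: "case_option t q \<in> space_time W \<longleftrightarrow> (q, t) \<in> W"
  by (simp add: space_time_def o_def)

lemma open_space_time:
  assumes "local_flow UNIV V U W \<Phi>"
  shows "open (space_time W)"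
proof -
  have "open W" using assms by (simp add: local_flow_def euclidean_product_topology)
  moreover have "continuous_on UNIV (\<lambda>z :: 'a option point. (z \<circ> Some, z None))"
    unfolding o_def
    by (intro continuous_on_Pair continuous_on_coordinatewise_then_product
        continuous_on_product_coordinates)
  ultimately have "open ((\<lambda>z. (z \<circ> Some, z None)) -` W)"
    by (rule open_vimage)
  then show ?thesis by (simp add: space_time_def vimage_def)
qed

lemma smooth_flow_component:
  assumes "local_flow UNIV V U W \<Phi>"
  shows "smooth_on UNIV (space_time W) (flow_component \<Phi> c)"
proof -
  have "\<forall>c. smooth_on (insert None (range Some))
      {z \<in> topspace (space_of (insert None (range Some))). (z \<circ> Some, z None) \<in> W}
      (\<lambda>z. \<Phi> (z None) (z \<circ> Some) c)"
    using assms unfolding local_flow_def by blast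
  then show ?thesis
    by (simp add: UNIV_option_conv[symmetric] space_time_def flow_component_def[abs_def])
qed

text \<open>Differentiating \<open>\<Phi> (t - s) (\<Phi> s q) = \<Phi> t q\<close> with respect to \<open>s\<close> at \<open>s = 0\<close>.\<close>

lemma flow_component_transport:
  assumes fl: "local_flow UNIV V U W \<Phi>" and p: "p \<in> U"
    and F: "finite F" "depends_only_on F (space_time W) (flow_component \<Phi> c)"
  shows "\<forall>\<^sub>F (q, t) in nhds (p, 0). (q, t) \<in> W \<and> q \<in> U \<and>
    (\<Sum>d\<in>F. partial d (flow_component \<Phi> c) (case_option t q) * case_option (-1) (V q) d) = 0"
proof -
  have univ: "restrict q UNIV = q" for q :: "'a point" by (simp add: fun_eq_iff)
  then have "restrict p UNIV \<in> U" using p by simp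
  then obtain N e where N: "open N" "p \<in> N" "e > 0" and
    group: "\<forall>q\<in>N. \<forall>s t. \<bar>s\<bar> < e \<longrightarrow> \<bar>t\<bar> < e \<longrightarrow>
      \<Phi> t (\<Phi> s (restrict q UNIV)) = \<Phi> (t + s) (restrict q UNIV)"
    by (rule local_flow_group[OF fl])
  have U: "open U" and W: "open W" "(p, 0) \<in> W"
    using fl p by (auto simp: local_flow_def euclidean_product_topology)
  \<comment> \<open>Half of e, so that t - s still has absolute value below e when s and t are below
    e/2.\<close>
  have "open ((N \<inter> U) \<times> {-e/2<..<e/2})" using N(1) U by (intro open_Times) auto
  then have "\<forall>\<^sub>F x in nhds (p, 0). x \<in> (N \<inter> U) \<times> {-e/2<..<e/2}"
    using N p by (intro eventually_nhds_in_open) auto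
  moreover have "\<forall>\<^sub>F x in nhds (p, 0). x \<in> W"
    using W by (rule eventually_nhds_in_open)
  ultimately show ?thesis
  proof eventually_elim
    case (elim x)
    obtain q t where x: "x = (q, t)" by force
    have q: "q \<in> N" "q \<in> U" and t: "\<bar>t\<bar> < e / 2" and W: "(q, t) \<in> W" using elim x by auto
    \<comment> \<open>The times s and t - s add up to t. Hence the time coordinate has velocity -1
      and the space coordinates start with velocity \<open>V q\<close>, which is
      \<open>case_option (-1) (V q)\<close>.\<close>
    define \<gamma> where "\<gamma> s = case_option (t - s) (\<Phi> s q)" for s
    have \<gamma>0: "\<gamma> 0 = case_option t q"
      using fl q by (simp add: \<gamma>_def local_flow_def)
    have "((\<lambda>s. flow_component \<Phi> c (\<gamma> s)) has_real_derivative
        (\<Sum>d\<in>F. partial d (flow_component \<Phi> c) (\<gamma> 0) * case_option (-1) (V q) d)) (at 0)"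
    proof (rule chain_rule_coordinates[OF open_space_time[OF fl] F])
      show "((\<lambda>h. flow_component \<Phi> c (z(d := h))) has_real_derivative
          partial d (flow_component \<Phi> c) z) (at (z d))" if "z \<in> space_time W" for d z
        by (rule smooth_on_has_partial[OF smooth_flow_component[OF fl] that])
      show "continuous_on (space_time W) (partial d (flow_component \<Phi> c))" for d
        by (rule smooth_on_continuous_partial[OF smooth_flow_component[OF fl]])
      show "((\<lambda>s. \<gamma> s d) has_real_derivative case_option (-1) (V q) d) (at 0)" for d
        using fl q by (cases d) (auto simp: \<gamma>_def local_flow_def intro!: derivative_eq_intros)
      show "\<gamma> 0 \<in> space_time W" using W by (simp add: \<gamma>0)
    qed
    moreover have "\<forall>\<^sub>F s in nhds 0. flow_component \<Phi> c (\<gamma> s) = \<Phi> t q c"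
      unfolding eventually_nhds_metric
    proof (intro exI[of _ "e / 2"] conjI allI impI)
      fix s :: real assume "dist s 0 < e / 2"
      then have "\<bar>s\<bar> < e" "\<bar>t - s\<bar> < e" using t N(3) by (auto simp: dist_real_def)
      then show "flow_component \<Phi> c (\<gamma> s) = \<Phi> t q c"
        using group[unfolded univ] q(1) by (simp add: \<gamma>_def)
    qed (use N in simp)
    ultimately have "((\<lambda>_. \<Phi> t q c) has_real_derivative
        (\<Sum>d\<in>F. partial d (flow_component \<Phi> c) (\<gamma> 0) * case_option (-1) (V q) d)) (at 0)"
      using DERIV_cong_ev[of 0 0 "\<lambda>s. flow_component \<Phi> c (\<gamma> s)" "\<lambda>_. \<Phi> t q c"] by simp
    from DERIV_unique[OF this DERIV_const] show ?case
      using W q by (simp add: x \<gamma>0)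
  qed
qed

text \<open>Scaling the high coordinates by \<open>s\<close> turns the transport equation into a polynomial equation
  in \<open>s\<close>, which holds near \<open>s = 1\<close> and hence also at \<open>s = 0\<close>, where only the terms of degree zero
  survive.\<close>

lemma flow_component_transport_low_part:
  assumes fl: "local_flow UNIV V U W \<Phi>" and p: "p \<in> U"
    and F: "finite F" "depends_only_on F (space_time W) (flow_component \<Phi> c)"
      "F \<subseteq> insert None (Some ` jet_coords k)"
    and V: "\<And>d. (\<lambda>q. V q d) \<in> jet_poly k"
  shows "\<forall>\<^sub>F (q, t) in nhds (p, 0). (q, t) \<in> W \<and> q \<in> U \<and>
    (\<Sum>d\<in>F. partial d (flow_component \<Phi> c) (case_option t q) *
      case_option (-1) (V (low_part k q)) d) = 0"
proof -
  obtain N e where N: "open N" "p \<in> N" "e > 0" and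
    box: "\<forall>q\<in>N. \<forall>t. \<bar>t\<bar> < e \<longrightarrow> (q, t) \<in> W \<and> q \<in> U \<and>
      (\<Sum>d\<in>F. partial d (flow_component \<Phi> c) (case_option t q) * case_option (-1) (V q) d) = 0"
    by (rule eventually_nhds_box[OF flow_component_transport[OF fl p F(1,2)]])
  have "open (N \<times> {-e<..<e})" using N(1) by (intro open_Times) auto
  then have "\<forall>\<^sub>F x in nhds (p, 0). x \<in> N \<times> {-e<..<e}"
    using N by (intro eventually_nhds_in_open) auto
  then show ?thesis
  proof (rule eventually_mono)
    fix x assume "x \<in> N \<times> {-e<..<e}"
    then obtain q t where x: "x = (q, t)" and q: "q \<in> N" and t: "\<bar>t\<bar> < e" by auto
    define r where "r s = (\<lambda>c. if c \<in> jet_coords k then q c else s * q c)" for s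
    define b where "b d = partial d (flow_component \<Phi> c) (case_option t q)" for d
    have "\<exists>P. \<forall>s. b d * case_option (-1) (V (r s)) d = poly P s" for d
    proof (cases d)
      case None
      then show ?thesis by (intro exI[of _ "[:- b d:]"]) simp
    next
      case (Some d')
      obtain P where "\<And>s. V (r s) d' = poly P s"
        using jet_poly_scaling[OF V[of d'], of q] unfolding r_def by blast
      then show ?thesis using Some by (intro exI[of _ "smult (b d) P"]) simp
    qed
    then obtain P where P: "\<And>d s. b d * case_option (-1) (V (r s)) d = poly (P d) s" by metis
    have "((\<lambda>s. r s) \<longlongrightarrow> q) (nhds 1)"
    proof (rule tendsto_componentwiseI)
      fix d
      have "((\<lambda>s. s * q d) \<longlongrightarrow> 1 * q d) (nhds 1)"
        by (intro tendsto_mult filterlim_ident tendsto_const)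
      then show "((\<lambda>s. r s d) \<longlongrightarrow> q d) (nhds 1)"
        by (cases "d \<in> jet_coords k") (simp_all add: r_def)
    qed
    then have "\<forall>\<^sub>F s in nhds 1. r s \<in> N"
      using topological_tendstoD N(1) q by blast
    then obtain \<delta> where \<delta>: "\<delta> > 0" "\<And>s. dist s 1 < \<delta> \<Longrightarrow> r s \<in> N"
      unfolding eventually_nhds_metric by blast
    have "poly (\<Sum>d\<in>F. P d) s = 0" if "dist s 1 < \<delta>" for s
    proof -
      have "r s \<in> N" by (rule \<delta>(2)[OF that])
      then have "(r s, t) \<in> W" and
        eq: "(\<Sum>d\<in>F. partial d (flow_component \<Phi> c) (case_option t (r s)) *
          case_option (-1) (V (r s)) d) = 0"
        using box t by auto
      \<comment> \<open>F contains only time and low coordinates, on which \<open>r s\<close> and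
        \<open>q\<close> agree, so s enters the equation through V alone.\<close>
      have "partial d (flow_component \<Phi> c) (case_option t (r s)) = b d" for d
        unfolding b_def
      proof (rule partial_cong_depends_only_on[OF open_space_time[OF fl] F(2)])
        fix d' assume "d' \<in> F"
        then show "case_option t (r s) d' = case_option t q d'"
          using F(3) by (auto simp: r_def split: option.split)
      qed (use box q t \<open>(r s, t) \<in> W\<close> in auto)
      with eq show ?thesis by (simp add: poly_sum P)
    qed
    then have "{1<..<1 + \<delta>} \<subseteq> {s. poly (\<Sum>d\<in>F. P d) s = 0}"
      by (auto simp: dist_real_def)
    moreover have "infinite {1<..<1 + \<delta>}" using \<delta>(1) by simp
    \<comment> \<open>Infinitely many zeros make the polynomial vanish identically. This licenses s
      = 0 although \<open>(r 0, t)\<close> may lie outside W, since the partials are already those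
      at q.\<close>
    ultimately have "(\<Sum>d\<in>F. P d) = 0"
      using poly_roots_finite finite_subset by blast
    then have "(\<Sum>d\<in>F. b d * case_option (-1) (V (r 0)) d) = 0"
      by (simp add: P poly_sum[symmetric])
    moreover have r0: "r 0 = low_part k q" by (simp add: r_def low_part_def fun_eq_iff)
    ultimately show "case x of (q, t) \<Rightarrow> (q, t) \<in> W \<and> q \<in> U \<and>
      (\<Sum>d\<in>F. partial d (flow_component \<Phi> c) (case_option t q) *
        case_option (-1) (V (low_part k q)) d) = 0"
      using box q t unfolding x b_def r0 by simp
  qed
qed

text \<open>The component \<open>\<Phi> (t - s) (e s) c\<close> is constant along the flow line \<open>e s\<close> of the truncated
  field, the coordinates outside \<open>jet_coords k\<close> being frozen at those of \<open>q\<close>.\<close>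

lemma truncated_flow_component_eq:
  assumes fl: "local_flow UNIV V U W \<Phi>" and p: "p \<in> U"
    and F: "finite F" "depends_only_on F (space_time W) (flow_component \<Phi> c)"
      "F \<subseteq> insert None (Some ` jet_coords k)"
    and V: "\<And>d. (\<lambda>q. V q d) \<in> jet_poly k"
    and T: "\<And>q d. T q d = V (low_part k q) d"
    and fl': "local_flow (jet_coords k) T U' W' \<Psi>" and p': "restrict p (jet_coords k) \<in> U'"
    and c: "c \<in> jet_coords k"
  shows "\<forall>\<^sub>F (q, t) in nhds (p, 0). \<Psi> t (restrict q (jet_coords k)) c = \<Phi> t q c"
proof -
  let ?J = "jet_coords k"
  define e where "e q t = (\<lambda>d. if d \<in> ?J then \<Psi> t (restrict q ?J) d else q d)" for q t
  obtain N a where N: "open N" "p \<in> N" "a > 0" and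
    box: "\<forall>q\<in>N. \<forall>t. \<bar>t\<bar> < a \<longrightarrow> (q, t) \<in> W \<and> q \<in> U \<and>
      (\<Sum>d\<in>F. partial d (flow_component \<Phi> c) (case_option t q) *
        case_option (-1) (V (low_part k q)) d) = 0"
    by (rule eventually_nhds_box[OF flow_component_transport_low_part[OF fl p F V]])
  have "((\<lambda>(q, t). e q t) \<longlongrightarrow> p) (nhds (p, 0))"
    using local_flow_tendsto[OF fl' p'] by (simp add: e_def)
  then have "\<forall>\<^sub>F (q, t) in nhds (p, 0). e q t \<in> N"
    using topological_tendstoD N(1,2) by (force simp: case_prod_unfold)
  then have "\<forall>\<^sub>F (q, t) in nhds (p, 0). e q t \<in> N \<and> (\<forall>d\<in>?J.
      ((\<lambda>s. \<Psi> s (restrict q ?J) d) has_real_derivative T (\<Psi> t (restrict q ?J)) d) (at t))"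
    using local_flow_ode[OF fl' p'] by eventually_elim auto
  then obtain N' a' where N': "open N'" "p \<in> N'" "a' > 0" and
    box': "\<forall>q\<in>N'. \<forall>t. \<bar>t\<bar> < a' \<longrightarrow> e q t \<in> N \<and> (\<forall>d\<in>?J.
      ((\<lambda>s. \<Psi> s (restrict q ?J) d) has_real_derivative T (\<Psi> t (restrict q ?J)) d) (at t))"
    by (rule eventually_nhds_box)
  \<comment> \<open>The half makes t - s smaller than a in absolute value, while s itself stays
    below a'.\<close>
  define \<epsilon> where "\<epsilon> = min a a' / 2"
  have \<epsilon>: "\<epsilon> > 0" "\<epsilon> < a'" "2 * \<epsilon> \<le> a" using N N' by (auto simp: \<epsilon>_def)
  let ?M = "N' \<inter> {q. restrict q ?J \<in> U'}"
  have "open (?M \<times> {-\<epsilon><..<\<epsilon>})"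
    using N'(1) open_initial_points[OF fl'] by (intro open_Times open_Int) auto
  then have "\<forall>\<^sub>F x in nhds (p, 0). x \<in> ?M \<times> {-\<epsilon><..<\<epsilon>}"
    using N' \<epsilon>(1) p' by (intro eventually_nhds_in_open) auto
  then show ?thesis
  proof (rule eventually_mono)
    fix x assume "x \<in> ?M \<times> {-\<epsilon><..<\<epsilon>}"
    then obtain q t where x: "x = (q, t)" and q: "q \<in> N'" "restrict q ?J \<in> U'" and t: "\<bar>t\<bar> < \<epsilon>"
      by auto
    have e0: "e q 0 = q"
      using fl' q(2) by (auto simp: e_def local_flow_def)
    have deriv: "((\<lambda>s. flow_component \<Phi> c (case_option (t - s) (e q s))) has_real_derivative 0) (at s)"
      if s: "\<bar>s\<bar> \<le> \<bar>t\<bar>" for s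
    proof -
      have eN: "e q s \<in> N" and
        ode: "\<And>d. d \<in> ?J \<Longrightarrow>
          ((\<lambda>s. \<Psi> s (restrict q ?J) d) has_real_derivative T (\<Psi> s (restrict q ?J)) d) (at s)"
        using box' q(1) s t \<epsilon> by auto
      have "\<bar>t - s\<bar> < a" using s t \<epsilon> by linarith
      then have W: "(e q s, t - s) \<in> W" and
        zero: "(\<Sum>d\<in>F. partial d (flow_component \<Phi> c) (case_option (t - s) (e q s)) *
          case_option (-1) (V (low_part k (e q s))) d) = 0"
        using box eN by auto
      \<comment> \<open>Frozen coordinates have velocity 0. On F, which has no high coordinates, v
        agrees with the truncated field.\<close>
      define v where "v d = (if d \<in> ?J then T (\<Psi> s (restrict q ?J)) d else 0)" for d
      have low: "low_part k (\<Psi> s (restrict q ?J)) = low_part k (e q s)"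
        by (simp add: low_part_def e_def fun_eq_iff)
      have "((\<lambda>s. flow_component \<Phi> c (case_option (t - s) (e q s))) has_real_derivative
          (\<Sum>d\<in>F. partial d (flow_component \<Phi> c) (case_option (t - s) (e q s)) *
            case_option (-1) v d)) (at s)"
      proof (rule chain_rule_coordinates[OF open_space_time[OF fl] F(1,2)])
        show "((\<lambda>h. flow_component \<Phi> c (z(d := h))) has_real_derivative
            partial d (flow_component \<Phi> c) z) (at (z d))" if "z \<in> space_time W" for d z
          by (rule smooth_on_has_partial[OF smooth_flow_component[OF fl] that])
        show "continuous_on (space_time W) (partial d (flow_component \<Phi> c))" for d
          by (rule smooth_on_continuous_partial[OF smooth_flow_component[OF fl]])
        show "((\<lambda>s. case_option (t - s) (e q s) d) has_real_derivative case_option (-1) v d) (at s)"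
          for d
          using ode by (cases d) (auto simp: e_def v_def intro!: derivative_eq_intros)
        show "case_option (t - s) (e q s) \<in> space_time W" using W by simp
      qed
      moreover have "case_option (-1) v d = case_option (-1) (V (low_part k (e q s))) d"
        if "d \<in> F" for d
        using F(3) that by (auto simp: v_def T low split: option.split)
      ultimately show ?thesis using zero by simp
    qed
    \<comment> \<open>The symmetric interval contains both 0 and t whatever the sign of t.\<close>
    obtain y where "\<forall>s\<in>{-\<bar>t\<bar>..\<bar>t\<bar>}. flow_component \<Phi> c (case_option (t - s) (e q s)) = y"
      using has_field_derivative_zero_constant[of "{-\<bar>t\<bar>..\<bar>t\<bar>}"
          "\<lambda>s. flow_component \<Phi> c (case_option (t - s) (e q s))"]
        has_field_derivative_at_within[OF deriv] by force
    then have "flow_component \<Phi> c (case_option (t - 0) (e q 0)) =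
        flow_component \<Phi> c (case_option (t - t) (e q t))"
      by (metis abs_ge_minus_self abs_ge_self abs_ge_zero atLeastAtMost_iff minus_le_iff
          neg_le_0_iff_le)
    then have "\<Phi> t q c = \<Phi> 0 (e q t) c" by (simp add: e0)
    \<comment> \<open>\<open>local_flow\<close> makes \<Phi> at time 0 the identity only on
      U.\<close>
    moreover have "e q t \<in> U"
    proof -
      have "e q t \<in> N" using box' q(1) t \<epsilon> by auto
      then show ?thesis using box N(3) by (metis abs_zero)
    qed
    ultimately have "\<Phi> t q c = e q t c" using fl by (simp add: local_flow_def)
    then show "case x of (q, t) \<Rightarrow> \<Psi> t (restrict q ?J) c = \<Phi> t q c"
      using c by (simp add: x e_def)
  qed
qed

section \<open>The bound on k and the final assembly\<close>

lemma jet_coords_mono: "j \<le> k \<Longrightarrow> jet_coords j \<subseteq> jet_coords k"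
  by (auto simp: jet_coords_def)

lemma finite_subset_jet_coords:
  fixes F :: "('n::finite, 'm) coord set"
  assumes "finite F"
  shows "\<exists>k. F \<subseteq> jet_coords k"
  using assms
proof induction
  case (insert c F)
  then obtain k where k: "F \<subseteq> jet_coords k" by blast
  have "\<exists>j. c \<in> jet_coords j"
    by (cases c) (auto simp: jet_coords_def)
  then obtain j where "c \<in> jet_coords j" by blast
  then have "insert c F \<subseteq> jet_coords (max j k)"
    using k jet_coords_mono[of j "max j k"] jet_coords_mono[of k "max j k"] by auto
  then show ?case by blast
qed simp

lemma mp_size_le:
  assumes "(\<lambda>(L, \<alpha>). YC L \<alpha>) ` A \<subseteq> jet_coords k"
  shows "mp_size A \<le> ereal (real k)"
  unfolding mp_size_def using assms by (intro SUP_least) (auto simp: jet_coords_def)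

theorem theorem4:
  fixes V :: "('n::finite, 'm::finite) coord vfield"
    and \<Phi> :: "real \<Rightarrow> ('n, 'm) coord point \<Rightarrow> ('n, 'm) coord point"
    and U :: "('n, 'm) coord point set"
    and W :: "(('n, 'm) coord point \<times> real) set"
    and C :: "('n, 'm) multipair set"
  assumes "lie_backlund V"
    and "exponentiable_on U V"
    and "local_flow UNIV V U W \<Phi>"
    and "finite C"
    and "\<forall>L. (L, \<lambda>_. 0) \<in> C"
  shows "\<exists>k0::real. mp_size (base_set V) \<le> ereal k0 \<and> mp_size C \<le> ereal k0 \<and>
    (\<forall>k::nat. k0 \<le> real k \<longrightarrow>
      (\<forall>U' W' \<Psi>. local_flow (jet_coords k) (truncated_field k V) U' W' \<Psi> \<longrightarrow>
        (\<forall>p\<in>U. restrict p (jet_coords k) \<in> U' \<longrightarrow>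
          (\<forall>\<^sub>F (q, t) in nhds (p, 0).
            (q, t) \<in> W \<and> (restrict q (jet_coords k), t) \<in> W' \<and>
            (\<forall>(L, \<alpha>)\<in>C. \<Psi> t (restrict q (jet_coords k)) (YC L \<alpha>) = \<Phi> t q (YC L \<alpha>)) \<and>
            (\<forall>i. \<Psi> t (restrict q (jet_coords k)) (XC i) = \<Phi> t q (XC i))))))"
proof -
  note fl = assms(3)
  have "\<exists>F. finite F \<and> depends_only_on F UNIV (\<lambda>p. V p c)" for c
    using assms(1) unfolding lie_backlund_def smooth_on_def by blast
  then obtain FV where FV: "\<And>c. finite (FV c)" "\<And>c. depends_only_on (FV c) UNIV (\<lambda>p. V p c)"
    by metis
  \<comment> \<open>One finite set works on all of W, which makes the bound independent of p and
    t.\<close>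
  have "\<exists>F. finite F \<and> depends_only_on F (space_time W) (flow_component \<Phi> c)" for c
    using smooth_flow_component[OF fl, of c] unfolding smooth_on_def by blast
  then obtain F\<Phi> where F\<Phi>: "\<And>c. finite (F\<Phi> c)"
    "\<And>c. depends_only_on (F\<Phi> c) (space_time W) (flow_component \<Phi> c)"
    by metis
  define base :: "('n, 'm) coord set" where "base = range XC \<union> range (\<lambda>L. YC L (\<lambda>_. 0))"
  define comps where "comps = range XC \<union> (\<lambda>(L, \<alpha>). YC L \<alpha>) ` C"
  \<comment> \<open>Everything that order k must cover: the coordinates seen by the coefficients in
    \<open>base\<close> (for polynomiality), \<open>base\<close> itself, the components to be
    compared, and the space coordinates on which these components of \<Phi> depend. A bound on their
    orders is the witness for k0.\<close>
  define low where "low = (\<Union>c\<in>base. FV c) \<union> base \<union> comps \<union> (\<Union>c\<in>comps. Some -` F\<Phi> c)"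
  have "finite low"
    using FV(1) F\<Phi>(1) assms(4) by (auto simp: low_def base_def comps_def finite_vimageI)
  then obtain j where j: "low \<subseteq> jet_coords j" using finite_subset_jet_coords by blast
  have base_dep: "depends_only_on (jet_coords k) UNIV (\<lambda>p. V p c)" if "j \<le> k" "c \<in> base" for k c
    using FV(2)[of c] by (rule depends_only_on_mono)
      (use that j jet_coords_mono[of j k] in \<open>auto simp: low_def\<close>)
  have "partial d (\<lambda>p. V p c) = (\<lambda>_. 0)" if "c \<in> base" "d \<notin> jet_coords j" for c d
    by (rule ext) (rule partial_eq_0[OF base_dep[OF order_refl that(1)] that(2)])
  then have "YC M \<beta> \<in> jet_coords j"
    if "partial (YC M \<beta>) (\<lambda>p. V p c) \<noteq> (\<lambda>_. 0)" "c \<in> base" for M \<beta> c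
    using that by blast
  moreover have "XC i \<in> base" "YC L (\<lambda>_. 0) \<in> base" for i L
    by (auto simp: base_def)
  moreover have "base \<subseteq> jet_coords j" using j by (simp add: low_def)
  ultimately have "mp_size (base_set V) \<le> ereal (real j)"
    by (intro mp_size_le) (fastforce simp: base_set_def)
  moreover have "mp_size C \<le> ereal (real j)"
    using j by (intro mp_size_le) (simp add: low_def comps_def)
  moreover have "\<forall>\<^sub>F (q, t) in nhds (p, 0).
      (q, t) \<in> W \<and> (restrict q (jet_coords k), t) \<in> W' \<and>
      (\<forall>(L, \<alpha>)\<in>C. \<Psi> t (restrict q (jet_coords k)) (YC L \<alpha>) = \<Phi> t q (YC L \<alpha>)) \<and>
      (\<forall>i. \<Psi> t (restrict q (jet_coords k)) (XC i) = \<Phi> t q (XC i))"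
    if k: "j \<le> k" and fl': "local_flow (jet_coords k) (truncated_field k V) U' W' \<Psi>"
      and p: "p \<in> U" "restrict p (jet_coords k) \<in> U'" for k U' W' \<Psi> p
  proof -
    have dep: "depends_only_on (jet_coords k) UNIV (\<lambda>p. V p (XC i))"
      "depends_only_on (jet_coords k) UNIV (\<lambda>p. V p (YC L (\<lambda>_. 0)))" for i L
      by (rule base_dep[OF k], simp add: base_def)+
    have low: "low \<subseteq> jet_coords k" using j jet_coords_mono[OF k] by blast
    \<comment> \<open>The neighbourhood of (p, 0) depends on the component; finitely many components
      leave a common one.\<close>
    have "\<forall>\<^sub>F x in nhds (p, 0). \<forall>c\<in>comps.
        \<Psi> (snd x) (restrict (fst x) (jet_coords k)) c = \<Phi> (snd x) (fst x) c"
    proof (rule eventually_ball_finite)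
      show "finite comps" using \<open>finite low\<close> by (simp add: low_def)
      show "\<forall>c\<in>comps. \<forall>\<^sub>F x in nhds (p, 0).
          \<Psi> (snd x) (restrict (fst x) (jet_coords k)) c = \<Phi> (snd x) (fst x) c"
      proof
        fix c assume c: "c \<in> comps"
        have "F\<Phi> c \<subseteq> insert None (Some ` jet_coords k)"
        proof
          fix d assume d: "d \<in> F\<Phi> c"
          show "d \<in> insert None (Some ` jet_coords k)"
          proof (cases d)
            case (Some d')
            then have "d' \<in> low" using c d unfolding low_def by blast
            then show ?thesis using low Some by blast
          qed simp
        qed
        then have "\<forall>\<^sub>F (q, t) in nhds (p, 0). \<Psi> t (restrict q (jet_coords k)) c = \<Phi> t q c"
          using low c
          by (intro truncated_flow_component_eq[OF fl p(1) F\<Phi>(1) F\<Phi>(2) _ _ _ fl' p(2)]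
              lie_backlund_jet_poly[OF assms(1) dep] truncated_field_eq[OF assms(1) dep])
             (auto simp: low_def)
        then show "\<forall>\<^sub>F x in nhds (p, 0).
            \<Psi> (snd x) (restrict (fst x) (jet_coords k)) c = \<Phi> (snd x) (fst x) c"
          by (simp add: case_prod_unfold)
      qed
    qed
    moreover have "\<forall>\<^sub>F x in nhds (p, 0). x \<in> W"
      using fl p by (intro eventually_nhds_in_open) (auto simp: local_flow_def euclidean_product_topology)
    moreover have "\<forall>\<^sub>F x in nhds (p, 0). x \<in> {(q, t). (restrict q (jet_coords k), t) \<in> W'}"
      using open_flow_domain[OF fl'] fl' p
      by (intro eventually_nhds_in_open) (auto simp: local_flow_def)
    ultimately show ?thesis
      by eventually_elim (auto simp: comps_def)
  qed
  ultimately show ?thesis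
    by (intro exI[of _ "real j"]) simp
qed

end
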